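(* Let $C = P + \varepsilon Q \in \mathbb{DH}[t]$, with $P, Q \in \mathbb{H}[t]$, be a monic unbounded motion polynomial such that all linear real factors of $\operatorname{mrpf} P$ have multiplicity one. Then there exists a nonzero real polynomial $D \in \mathbb{R}[t]$ such that $CD$ admits a factorization with linear motion polynomial factors, i.e., there are dual quaternions $h_1,\dots,h_n$ (with $n = \deg(CD)$) and a leading coefficient $c$ of $CD$ such that $CD = c\,(t-h_1)(t-h_2)\cdots(t-h_n)$ and each $t-h_i$ is a motion polynomial.
   Context: $\mathbb{H}$ denotes the (Hamilton) quaternions. The dual quaternions are $\mathbb{DH} = \mathbb{H}\otimes_{\mathbb{R}}\mathbb{D}$ with $\mathbb{D}=\mathbb{R}[\varepsilon]/\langle\varepsilon^2\rangle$ the dual numbers; every element is uniquely $a+\varepsilon b$ with $a,b\in\mathbb{H}$, where $\varepsilon$ is central and $\varepsilon^2=0$. Conjugation is $(a+\varepsilon b)^\ast = a^\ast+\varepsilon b^\ast$, with $a^\ast$ the usual quaternion conjugate. For a ring $R$, $R[t]$ is the ring of polynomials in $t$ with coefficients written on the left, where $t$ commutes with all coefficients. Conjugation extends to $\mathbb{DH}[t]$ coefficientwise, and $\nu(C)=CC^\ast$. A polynomial $C=P+\varepsilon Q\in\mathbb{DH}[t]$ with $P,Q\in\mathbb{H}[t]$ is called a motion polynomial if $\nu(C)\in\mathbb{R}[t]$ and $\nu(C)\neq 0$. For $P\in\mathbb{H}[t]$, $P \neq 0$, $\operatorname{mrpf}P$ denotes the unique monic polynomial in $\mathbb{R}[t]$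 of maximal degree that is a factor of $P$ (the maximal real polynomial factor). The motion polynomial $C = P+\varepsilon Q$ is called bounded if $\operatorname{mrpf}P$ has no real zeros, and unbounded otherwise. *)

theory Defs
  imports Complex_Main "HOL-Library.Poly_Mapping" "HOL-Computational_Algebra.Polynomial"
begin

section \<open>Hamilton quaternions\<close>

datatype quat = Quat (qRe: real) (qIm1: real) (qIm2: real) (qIm3: real)

lemma quat_eq_iff:
  "x = y \<longleftrightarrow> qRe x = qRe y \<and> qIm1 x = qIm1 y \<and> qIm2 x = qIm2 y \<and> qIm3 x = qIm3 y"
  by (auto intro: quat.expand)

instantiation quat :: real_div_algebra
begin

definition zero_quat :: quat where "0 = Quat 0 0 0 0"

definition one_quat :: quat where "1 = Quat 1 0 0 0"

definition plus_quat :: "quat \<Rightarrow> quat \<Rightarrow> quat" where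
  "x + y = Quat (qRe x + qRe y) (qIm1 x + qIm1 y) (qIm2 x + qIm2 y) (qIm3 x + qIm3 y)"

definition uminus_quat :: "quat \<Rightarrow> quat" where
  "- x = Quat (- qRe x) (- qIm1 x) (- qIm2 x) (- qIm3 x)"

definition minus_quat :: "quat \<Rightarrow> quat \<Rightarrow> quat" where
  "x - y = Quat (qRe x - qRe y) (qIm1 x - qIm1 y) (qIm2 x - qIm2 y) (qIm3 x - qIm3 y)"

definition times_quat :: "quat \<Rightarrow> quat \<Rightarrow> quat" where
  "x * y = Quat
    (qRe x * qRe y - qIm1 x * qIm1 y - qIm2 x * qIm2 y - qIm3 x * qIm3 y)
    (qRe x * qIm1 y + qIm1 x * qRe y + qIm2 x * qIm3 y - qIm3 x * qIm2 y)
    (qRe x * qIm2 y - qIm1 x * qIm3 y + qIm2 x * qRe y + qIm3 x * qIm1 y)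
    (qRe x * qIm3 y + qIm1 x * qIm2 y - qIm2 x * qIm1 y + qIm3 x * qRe y)"

definition scaleR_quat :: "real \<Rightarrow> quat \<Rightarrow> quat" where
  "r *\<^sub>R x = Quat (r * qRe x) (r * qIm1 x) (r * qIm2 x) (r * qIm3 x)"

definition inverse_quat :: "quat \<Rightarrow> quat" where
  "inverse x = (let n = (qRe x)\<^sup>2 + (qIm1 x)\<^sup>2 + (qIm2 x)\<^sup>2 + (qIm3 x)\<^sup>2
     in Quat (qRe x / n) (- qIm1 x / n) (- qIm2 x / n) (- qIm3 x / n))"

definition divide_quat :: "quat \<Rightarrow> quat \<Rightarrow> quat" where
  "x div y = x * inverse (y :: quat)"

instance
proof
  fix x y z :: quat and a b :: real
  note defs = quat_eq_iff zero_quat_def one_quat_def plus_quat_def uminus_quat_def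
    minus_quat_def times_quat_def scaleR_quat_def
  show "x + y + z = x + (y + z)" "x + y = y + x" "0 + x = x" "- x + x = 0" "x - y = x + - y"
    "x * y * z = x * (y * z)" "1 * x = x" "x * 1 = x" "(x + y) * z = x * z + y * z"
    "x * (y + z) = x * y + x * z" "(0 :: quat) \<noteq> 1"
    "a *\<^sub>R (x + y) = a *\<^sub>R x + a *\<^sub>R y" "(a + b) *\<^sub>R x = a *\<^sub>R x + b *\<^sub>R x"
    "a *\<^sub>R b *\<^sub>R x = (a * b) *\<^sub>R x" "1 *\<^sub>R x = x"
    "a *\<^sub>R x * y = a *\<^sub>R (x * y)" "x * a *\<^sub>R y = a *\<^sub>R (x * y)"
    by (simp_all add: defs algebra_simps)
  show "x div y = x * inverse y" by (simp add: divide_quat_def)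
  show "inverse (0 :: quat) = 0" by (simp add: inverse_quat_def zero_quat_def)
  assume "x \<noteq> 0"
  define n where "n = (qRe x)\<^sup>2 + (qIm1 x)\<^sup>2 + (qIm2 x)\<^sup>2 + (qIm3 x)\<^sup>2"
  have n: "n \<noteq> 0"
    using \<open>x \<noteq> 0\<close> by (auto simp: n_def quat_eq_iff zero_quat_def add_nonneg_eq_0_iff)
  have inv: "inverse x = Quat (qRe x / n) (- qIm1 x / n) (- qIm2 x / n) (- qIm3 x / n)"
    by (simp add: inverse_quat_def n_def Let_def)
  have sum: "(qRe x * qRe x + qIm1 x * qIm1 x + qIm2 x * qIm2 x + qIm3 x * qIm3 x) / n = 1"
    using n by (simp add: n_def power2_eq_square)
  show "inverse x * x = 1" "x * inverse x = 1"
    using sum by (simp_all add: inv quat_eq_iff times_quat_def one_quat_def add_divide_distrib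
        mult.commute)
qed

end

definition qcnj :: "quat \<Rightarrow> quat" where
  "qcnj x = Quat (qRe x) (- qIm1 x) (- qIm2 x) (- qIm3 x)"


section \<open>Dual quaternions\<close>

text \<open>\<open>Dual a b\<close> stands for \<open>a + \<epsilon> b\<close>, with \<open>\<epsilon>\<close> central and of square zero.\<close>

datatype 'a dual = Dual (primal: 'a) (dualp: 'a)

lemma dual_eq_iff: "x = y \<longleftrightarrow> primal x = primal y \<and> dualp x = dualp y"
  by (auto intro: dual.expand)

instantiation dual :: (real_algebra_1) real_algebra_1
begin

definition zero_dual :: "'a dual" where "0 = Dual 0 0"

definition one_dual :: "'a dual" where "1 = Dual 1 0"

definition plus_dual :: "'a dual \<Rightarrow> 'a dual \<Rightarrow> 'a dual" where
  "x + y = Dual (primal x + primal y) (dualp x + dualp y)"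

definition uminus_dual :: "'a dual \<Rightarrow> 'a dual" where
  "- x = Dual (- primal x) (- dualp x)"

definition minus_dual :: "'a dual \<Rightarrow> 'a dual \<Rightarrow> 'a dual" where
  "x - y = Dual (primal x - primal y) (dualp x - dualp y)"

definition times_dual :: "'a dual \<Rightarrow> 'a dual \<Rightarrow> 'a dual" where
  "x * y = Dual (primal x * primal y) (primal x * dualp y + dualp x * primal y)"

definition scaleR_dual :: "real \<Rightarrow> 'a dual \<Rightarrow> 'a dual" where
  "r *\<^sub>R x = Dual (r *\<^sub>R primal x) (r *\<^sub>R dualp x)"

instance
  by standard
    (simp_all add: dual_eq_iff zero_dual_def one_dual_def plus_dual_def uminus_dual_def
      minus_dual_def times_dual_def scaleR_dual_def algebra_simps)

end

definition dual_eps :: "'a :: real_algebra_1 dual" where "dual_eps = Dual 0 1"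

definition dual_of :: "'a :: real_algebra_1 \<Rightarrow> 'a dual" where "dual_of a = Dual a 0"

type_synonym dquat = "quat dual"

definition dqcnj :: "dquat \<Rightarrow> dquat" where
  "dqcnj x = Dual (qcnj (primal x)) (qcnj (dualp x))"


section \<open>Polynomials with non-commuting coefficients\<close>

text \<open>
  The type \<^typ>\<open>'a poly\<close> carries a multiplication only for commutative coefficients. For
  a non-commutative ring we use finitely supported functions \<^typ>\<open>nat \<Rightarrow>\<^sub>0 'a\<close> with the
  convolution product, so that the indeterminate \<open>single 1 1\<close> commutes with all coefficients.
  Real polynomials remain in \<^typ>\<open>real poly\<close> and are embedded by \<open>of_rpoly\<close>.
\<close>

type_synonym 'a ncpoly = "nat \<Rightarrow>\<^sub>0 'a"

definition ncconst :: "'a :: zero \<Rightarrow> 'a ncpoly" where "ncconst a = Poly_Mapping.single 0 a"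

definition ncvar :: "'a :: zero_neq_one ncpoly" where "ncvar = Poly_Mapping.single 1 1"

text \<open>\<^const>\<open>Poly_Mapping.degree\<close> is the usual degree plus one.\<close>

definition ncdegree :: "'a :: zero ncpoly \<Rightarrow> nat" where
  "ncdegree p = Max (insert 0 (Poly_Mapping.keys p))"

definition nclead :: "'a :: zero ncpoly \<Rightarrow> 'a" where
  "nclead p = Poly_Mapping.lookup p (ncdegree p)"

definition ncmonic :: "'a :: zero_neq_one ncpoly \<Rightarrow> bool" where
  "ncmonic p \<longleftrightarrow> nclead p = 1"

lift_definition of_rpoly :: "real poly \<Rightarrow> 'a :: real_algebra_1 ncpoly"
  is "\<lambda>p n. of_real (p n)"
  by (auto simp: MOST_iff_cofinite)

lemma lookup_of_rpoly: "Poly_Mapping.lookup (of_rpoly p) n = of_real (coeff p n)"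
  by (simp add: of_rpoly.rep_eq)


section \<open>Motion polynomials\<close>

definition dual_poly :: "quat ncpoly \<Rightarrow> quat ncpoly \<Rightarrow> dquat ncpoly" where
  "dual_poly P Q =
     Poly_Mapping.map dual_of P + ncconst dual_eps * Poly_Mapping.map dual_of Q"

definition primal_poly :: "dquat ncpoly \<Rightarrow> quat ncpoly" where
  "primal_poly C = Poly_Mapping.map primal C"

definition cnj_poly :: "dquat ncpoly \<Rightarrow> dquat ncpoly" where
  "cnj_poly C = Poly_Mapping.map dqcnj C"

definition norm_poly :: "dquat ncpoly \<Rightarrow> dquat ncpoly" where
  "norm_poly C = C * cnj_poly C"

definition motion_poly :: "dquat ncpoly \<Rightarrow> bool" where
  "motion_poly C \<longleftrightarrow> norm_poly C \<in> range of_rpoly \<and> norm_poly C \<noteq> 0"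

definition real_factor :: "real poly \<Rightarrow> quat ncpoly \<Rightarrow> bool" where
  "real_factor M P \<longleftrightarrow> (\<exists>R. P = of_rpoly M * R)"

text \<open>Only meaningful for \<open>P \<noteq> 0\<close>.\<close>

definition mrpf :: "quat ncpoly \<Rightarrow> real poly" where
  "mrpf P = (THE M. lead_coeff M = 1 \<and> real_factor M P \<and>
     (\<forall>N. lead_coeff N = 1 \<and> real_factor N P \<longrightarrow> degree N \<le> degree M))"

definition bounded_motion_poly :: "dquat ncpoly \<Rightarrow> bool" where
  "bounded_motion_poly C \<longleftrightarrow>
     motion_poly C \<and> (\<forall>r :: real. poly (mrpf (primal_poly C)) r \<noteq> 0)"

definition unbounded_motion_poly :: "dquat ncpoly \<Rightarrow> bool" where
  "unbounded_motion_poly C \<longleftrightarrow> motion_poly C \<and> \<not> bounded_motion_poly C"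

lemma primal_poly_dual_poly [simp]: "primal_poly (dual_poly P Q) = P"
proof (rule poly_mapping_eqI)
  fix n
  have "Poly_Mapping.lookup (ncconst dual_eps * p) n = dual_eps * Poly_Mapping.lookup p n"
    for p :: "dquat ncpoly"
    by (cases "dual_eps * Poly_Mapping.lookup p n = 0")
      (auto simp: ncconst_def lookup_mult lookup_single when_mult when_def Sum_any.expand_set
        cong: conj_cong)
  then show "Poly_Mapping.lookup (primal_poly (dual_poly P Q)) n = Poly_Mapping.lookup P n"
    by (auto simp: primal_poly_def dual_poly_def map.rep_eq lookup_add when_def dual_of_def
        dual_eps_def times_dual_def plus_dual_def zero_dual_def)
qed

end

theory Submission
  imports Defs "HOL-Computational_Algebra.Polynomial_Factorial"
    "HOL-Computational_Algebra.Field_as_Ring"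
    "HOL-Computational_Algebra.Fundamental_Theorem_Algebra"
begin

text \<open>
  Write \<open>\<nu>(P) = P P\<^sup>*\<close>. The condition that \<open>\<nu>(C)\<close> is real says exactly that \<open>V = Q P\<^sup>*\<close> is purely
  vectorial, so \<open>C P\<^sup>* = \<nu>(P) + \<epsilon> V\<close> is a translation \<open>1 + \<epsilon> V / \<nu>(P)\<close> up to a real factor. From
  \<open>C \<nu>(P) = (\<nu>(P) + \<epsilon> V) P\<close> it follows that \<open>C\<close> has a real multiple that is a product of linear
  motion polynomials as soon as both \<open>P\<close> and \<open>\<nu>(P) + \<epsilon> V\<close> have one
  (\<open>factors_motion_poly\<close>). Real multiples may be inserted and removed freely, because every
  nonzero real polynomial splits itself into linear motion polynomials up to a constant:
  \<open>(t - s)\<^sup>2 + m\<^sup>2 = (t - s - m i) (t - s + m i)\<close>.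

  The factor \<open>P\<close> is handled by the fundamental theorem of algebra for quaternions
  (\<open>factors_monic_quat_poly\<close>).

  For translations what matters is the vector of rational functions \<open>f = V / w\<close>
  (\<open>factors_translation_cong\<close>), and multiplying translations adds these vectors
  (\<open>factors_translation_add\<close>). Partial fractions therefore reduce everything to the following
  elementary summands with a constant vector \<open>u\<close>. A simple real pole \<open>u / (t - r)\<close> is the linear
  motion polynomial \<open>t - r + \<epsilon> u\<close>. A simple nonreal pole, with \<open>N = (t - s)\<^sup>2 + m\<^sup>2\<close>, comes from
  the factored circular translations \<open>(t - s - m e) (t - s + m e + \<epsilon> w)\<close>, where the unit vector \<open>e\<close>
  is orthogonal to \<open>w\<close>: adding up the ones for \<open>e\<close> and \<open>-e\<close> straightens the circle. Higher
  powers of \<open>N\<close> in the denominator come from conjugation with \<open>t - s - m e\<close>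
  (\<open>directions_times_quadratic\<close>). Only multiple real poles are not covered.

  They do not occur here: if \<open>G = mrpf P\<close> and \<open>P = G P'\<close>, then
  \<open>V / \<nu>(P) = Q P'\<^sup>* / (G \<nu>(P'))\<close>. A real zero of \<open>\<nu>(P')\<close> would be a zero of \<open>P'\<close>,
  contradicting the maximality of \<open>G\<close>, so the real poles are zeros of \<open>G\<close>, which are simple by
  hypothesis.
\<close>

section \<open>Evaluation at real points\<close>

lemma lookup_mult_nat:
  fixes p q :: "'a :: semiring_0 ncpoly"
  shows "Poly_Mapping.lookup (p * q) k
    = (\<Sum>i\<le>k. Poly_Mapping.lookup p i * Poly_Mapping.lookup q (k - i))"
proof -
  have inner: "(\<Sum>j. Poly_Mapping.lookup q j when k = i + j)
      = (Poly_Mapping.lookup q (k - i) when i \<le> k)" for i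
  proof (cases "i \<le> k")
    case True
    then have "k = i + j \<longleftrightarrow> j = k - i" for j
      by auto
    with True show ?thesis
      by simp
  next
    case False
    then have "k \<noteq> i + j" for j
      by auto
    with False show ?thesis
      by simp
  qed
  show ?thesis
    unfolding lookup_mult inner
    by (subst Sum_any.expand_superset[where A = "{..k}"]) (auto simp: mult_when)
qed

text \<open>
  Real numbers are central, so evaluation at a real point is multiplicative even though the
  coefficients do not commute. Since polynomials are determined by their values at all real
  points, an identity between them can be checked pointwise in real coordinates.
\<close>

definition ev :: "'a :: real_algebra_1 ncpoly \<Rightarrow> real \<Rightarrow> 'a" where
  "ev p x = (\<Sum>n\<in>Poly_Mapping.keys p. x ^ n *\<^sub>R Poly_Mapping.lookup p n)"

lemma ev_superset:
  assumes "finite A" "Poly_Mapping.keys p \<subseteq> A"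
  shows "ev p x = (\<Sum>n\<in>A. x ^ n *\<^sub>R Poly_Mapping.lookup p n)"
  unfolding ev_def using assms
  by (intro sum.mono_neutral_left) (auto simp: in_keys_iff)

lemma ev_add [simp]: "ev (p + q) x = ev p x + ev q x"
proof -
  let ?A = "Poly_Mapping.keys p \<union> Poly_Mapping.keys q"
  have "Poly_Mapping.keys (p + q) \<subseteq> ?A"
    by (rule keys_add)
  then show ?thesis
    by (simp add: ev_superset[of ?A] lookup_add scaleR_add_right sum.distrib)
qed

lemma ev_zero [simp]: "ev 0 x = 0"
  by (simp add: ev_def)

lemma ev_uminus [simp]: "ev (- p) x = - ev p x"
  using ev_add[of p "- p" x] by (simp add: eq_neg_iff_add_eq_0 add.commute)

lemma ev_diff [simp]: "ev (p - q) x = ev p x - ev q x"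
  using ev_add[of p "- q" x] by simp

lemma ev_single [simp]: "ev (Poly_Mapping.single n a) x = x ^ n *\<^sub>R a"
  by (subst ev_superset[where A = "{n}"]) auto

lemma ev_one [simp]: "ev 1 x = 1"
  using ev_single[of 0 1 x] by simp

lemma ncpoly_induct [case_names zero add_single]:
  assumes "P 0" and "\<And>p n a. P p \<Longrightarrow> P (p + Poly_Mapping.single n a)"
  shows "P p"
proof (induction p rule: update_induct)
  case const
  show ?case by fact
next
  case (update f a b)
  have "Poly_Mapping.update a b f = f + Poly_Mapping.single a b"
    using update.hyps by (intro poly_mapping_eqI)
      (auto simp: lookup_update lookup_add lookup_single when_def in_keys_iff)
  then show ?case
    using assms(2) update.IH by metis
qed

lemma ev_mult [simp]: "ev (p * q) x = ev p x * ev q x"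
proof (induction p rule: ncpoly_induct)
  case (add_single p n a)
  have "ev (Poly_Mapping.single n a * q) x = x ^ n *\<^sub>R a * ev q x"
  proof (induction q rule: ncpoly_induct)
    case (add_single q m b)
    then show ?case
      by (simp add: distrib_left mult_single power_add)
  qed simp
  with add_single show ?case
    by (simp add: distrib_right)
qed simp

lemma ev_const [simp]: "ev (ncconst a) x = a"
  by (simp add: ncconst_def)

lemma ev_var [simp]: "ev ncvar x = of_real x"
  by (simp add: ncvar_def of_real_def)

lemma ev_of_rpoly [simp]: "ev (of_rpoly p) x = of_real (poly p x)"
proof -
  have "ev (of_rpoly p :: 'a ncpoly) x
      = (\<Sum>n\<le>degree p. x ^ n *\<^sub>R Poly_Mapping.lookup (of_rpoly p :: 'a ncpoly) n)"
    by (intro ev_superset) (auto simp: in_keys_iff lookup_of_rpoly intro: le_degree)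
  also have "\<dots> = of_real (poly p x)"
    unfolding poly_altdef of_real_sum lookup_of_rpoly
    by (intro sum.cong) (simp_all add: of_real_def mult.commute)
  finally show ?thesis .
qed

lemma lookup_map_linear:
  assumes "linear f"
  shows "Poly_Mapping.lookup (Poly_Mapping.map f p) n = f (Poly_Mapping.lookup p n)"
  using linear_0[OF assms] by (simp add: map.rep_eq when_def)

lemma ev_map:
  assumes "linear f"
  shows "ev (Poly_Mapping.map f p) x = f (ev p x)"
proof -
  have "ev (Poly_Mapping.map f p) x
      = (\<Sum>n\<in>Poly_Mapping.keys p. x ^ n *\<^sub>R Poly_Mapping.lookup (Poly_Mapping.map f p) n)"
    using linear_0[OF assms] by (intro ev_superset) (auto simp: in_keys_iff lookup_map_linear[OF assms])
  then show ?thesis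
    by (simp add: ev_def lookup_map_linear[OF assms] linear_sum[OF assms] linear_cmul[OF assms])
qed

definition coord :: "('a :: real_algebra_1 \<Rightarrow> real) \<Rightarrow> 'a ncpoly \<Rightarrow> real poly" where
  "coord f p = Abs_poly (\<lambda>n. f (Poly_Mapping.lookup p n))"

lemma coeff_coord:
  assumes "linear f"
  shows "coeff (coord f p) n = f (Poly_Mapping.lookup p n)"
proof -
  have "finite {n. Poly_Mapping.lookup p n \<noteq> 0}"
    by simp
  then have "finite {n. f (Poly_Mapping.lookup p n) \<noteq> 0}"
    by (rule rev_finite_subset) (auto simp: linear_0[OF assms])
  then show ?thesis
    unfolding coord_def by (subst Abs_poly_inverse) (auto simp: MOST_iff_cofinite)
qed

lemma poly_coord:
  assumes "linear f"
  shows "poly (coord f p) x = f (ev p x)"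
proof -
  have "poly (coord f p) x
      = (\<Sum>n\<in>{..degree (coord f p)} \<union> Poly_Mapping.keys p. coeff (coord f p) n * x ^ n)"
    unfolding poly_altdef by (rule sum.mono_neutral_left) (auto simp: coeff_eq_0)
  also have "\<dots> = f (\<Sum>n\<in>{..degree (coord f p)} \<union> Poly_Mapping.keys p.
      x ^ n *\<^sub>R Poly_Mapping.lookup p n)"
    by (simp add: linear_sum[OF assms] linear_cmul[OF assms] coeff_coord[OF assms] mult.commute)
  also have "\<dots> = f (ev p x)"
    by (subst ev_superset) auto
  finally show ?thesis .
qed

text \<open>
  A family of real-linear functionals that separates the coefficients reduces equality to that of
  real polynomials, which are determined by their values.
\<close>

lemma ev_eqI_coords:
  fixes p q :: "'a :: real_algebra_1 ncpoly" and F :: "('a \<Rightarrow> real) set"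
  assumes "\<And>x. ev p x = ev q x"
    and lin: "\<And>f. f \<in> F \<Longrightarrow> linear f"
    and sep: "\<And>a b. \<forall>f\<in>F. f a = f b \<Longrightarrow> a = b"
  shows "p = q"
proof (rule poly_mapping_eqI, rule sep, rule ballI)
  fix n f assume f: "f \<in> F"
  have "coord f p = coord f q"
    using assms(1) by (simp add: poly_eq_poly_eq_iff[symmetric] fun_eq_iff poly_coord[OF lin[OF f]])
  then show "f (Poly_Mapping.lookup p n) = f (Poly_Mapping.lookup q n)"
    by (metis coeff_coord lin f)
qed

section \<open>Coordinates of quaternions and dual quaternions\<close>

lemmas quat_ops = zero_quat_def one_quat_def plus_quat_def uminus_quat_def minus_quat_def
  times_quat_def scaleR_quat_def

lemmas dual_ops = zero_dual_def one_dual_def plus_dual_def uminus_dual_def minus_dual_def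
  times_dual_def scaleR_dual_def

lemma of_real_quat: "of_real r = Quat r 0 0 0"
  by (simp add: of_real_def quat_ops)

lemma of_real_dual: "of_real r = Dual (of_real r) 0"
  by (simp add: of_real_def dual_ops)

lemma linear_quat_coords: "linear qRe" "linear qIm1" "linear qIm2" "linear qIm3" "linear qcnj"
  by (auto intro!: linearI simp: quat_ops qcnj_def)

lemma linear_dual_coords: "linear primal" "linear dualp" "linear dual_of" "linear dqcnj"
  by (auto intro!: linearI simp: dual_ops dual_of_def dqcnj_def
      linear_add[OF linear_quat_coords(5)] linear_cmul[OF linear_quat_coords(5)])

lemma quat_ncpoly_eqI:
  fixes p q :: "quat ncpoly"
  assumes "\<And>x. ev p x = ev q x"
  shows "p = q"
  by (rule ev_eqI_coords[where F = "{qRe, qIm1, qIm2, qIm3}"])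
    (use assms linear_quat_coords in \<open>auto simp: quat_eq_iff\<close>)

lemma dquat_ncpoly_eqI:
  fixes p q :: "dquat ncpoly"
  assumes "\<And>x. ev p x = ev q x"
  shows "p = q"
proof (rule ev_eqI_coords[where F = "(\<lambda>f. f \<circ> primal) ` {qRe, qIm1, qIm2, qIm3}
      \<union> (\<lambda>f. f \<circ> dualp) ` {qRe, qIm1, qIm2, qIm3}"])
qed (use assms linear_quat_coords linear_dual_coords in
    \<open>auto simp: dual_eq_iff quat_eq_iff intro!: linear_compose\<close>)

lemma ev_dual_poly [simp]: "ev (dual_poly P Q) x = Dual (ev P x) (ev Q x)"
  by (simp add: dual_poly_def ev_map linear_dual_coords dual_eps_def dual_ops dual_of_def)

lemma ev_cnj_poly [simp]: "ev (cnj_poly C) x = dqcnj (ev C x)"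
  by (simp add: cnj_poly_def ev_map linear_dual_coords)

definition qpoly :: "real poly \<Rightarrow> real poly \<Rightarrow> real poly \<Rightarrow> real poly \<Rightarrow> quat ncpoly" where
  "qpoly a b c d = of_rpoly a + ncconst (Quat 0 1 0 0) * of_rpoly b
     + ncconst (Quat 0 0 1 0) * of_rpoly c + ncconst (Quat 0 0 0 1) * of_rpoly d"

lemma ev_qpoly [simp]: "ev (qpoly a b c d) x = Quat (poly a x) (poly b x) (poly c x) (poly d x)"
  by (simp add: qpoly_def of_real_quat quat_ops)

lemma lookup_ncconst_mult:
  "Poly_Mapping.lookup (ncconst u * p) n = u * Poly_Mapping.lookup p n"
  for u :: "'a :: semiring_0"
  by (simp add: lookup_mult_nat ncconst_def lookup_single when_def if_distrib if_distribR
      sum.delta cong: if_cong)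

lemma lookup_qpoly:
  "Poly_Mapping.lookup (qpoly a b c d) n = Quat (coeff a n) (coeff b n) (coeff c n) (coeff d n)"
  by (simp add: qpoly_def lookup_add lookup_of_rpoly lookup_ncconst_mult of_real_quat quat_ops)

lemma lookup_dual_poly:
  "Poly_Mapping.lookup (dual_poly P Q) n
    = Dual (Poly_Mapping.lookup P n) (Poly_Mapping.lookup Q n)"
  by (simp add: dual_poly_def lookup_add lookup_ncconst_mult lookup_map_linear linear_dual_coords
      dual_eps_def dual_of_def dual_ops)

lemma qpoly_coords: "P = qpoly (coord qRe P) (coord qIm1 P) (coord qIm2 P) (coord qIm3 P)"
  by (rule quat_ncpoly_eqI) (simp add: poly_coord linear_quat_coords)

lemma qpoly_inject: "qpoly a b c d = qpoly a' b' c' d' \<longleftrightarrow> a = a' \<and> b = b' \<and> c = c' \<and> d = d'"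
  by (auto simp: poly_eq_iff lookup_qpoly poly_mapping_eq_iff fun_eq_iff)

section \<open>Leading coefficients\<close>

text \<open>
  The degree \<open>n\<close> is passed explicitly and \<open>a = 0\<close> is permitted, which makes this notion stable under
  products even in rings with zero divisors such as the dual quaternions.
\<close>

definition lead_at :: "nat \<Rightarrow> 'a :: zero ncpoly \<Rightarrow> 'a \<Rightarrow> bool" where
  "lead_at n p a \<longleftrightarrow> Poly_Mapping.lookup p n = a \<and> (\<forall>k>n. Poly_Mapping.lookup p k = 0)"

lemma lead_at_mult:
  fixes p q :: "'a :: semiring_0 ncpoly"
  assumes "lead_at n p a" "lead_at m q b"
  shows "lead_at (n + m) (p * q) (a * b)"
proof -
  have zero: "Poly_Mapping.lookup p i * Poly_Mapping.lookup q (k - i) = 0"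
    if "n + m < k \<or> k = n + m \<and> i \<noteq> n" for i k
  proof -
    have "n < i \<or> m < k - i"
      using that by auto
    then show ?thesis
      using assms by (auto simp: lead_at_def)
  qed
  have "Poly_Mapping.lookup (p * q) (n + m)
      = (\<Sum>i\<in>{n}. Poly_Mapping.lookup p i * Poly_Mapping.lookup q (n + m - i))"
    unfolding lookup_mult_nat by (rule sum.mono_neutral_right) (auto intro: zero)
  moreover have "Poly_Mapping.lookup (p * q) k = 0" if "k > n + m" for k
    unfolding lookup_mult_nat using that by (intro sum.neutral) (auto intro: zero)
  ultimately show ?thesis
    using assms by (auto simp: lead_at_def)
qed

lemma lead_at_ncdegree: "lead_at (ncdegree p) p (nclead p)"
proof -
  have "Poly_Mapping.lookup p k = 0" if "k > ncdegree p" for k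
  proof (rule ccontr)
    assume "Poly_Mapping.lookup p k \<noteq> 0"
    then have "k \<le> ncdegree p"
      unfolding ncdegree_def by (intro Max_ge) (auto simp: in_keys_iff)
    with that show False by simp
  qed
  then show ?thesis
    by (simp add: lead_at_def nclead_def)
qed

lemma lead_at_unique:
  assumes "lead_at n p a" "lead_at m p b" "a \<noteq> 0" "b \<noteq> 0"
  shows "n = m" "a = b"
proof -
  show "n = m"
    using assms unfolding lead_at_def by (metis linorder_neqE_nat)
  with assms show "a = b"
    by (simp add: lead_at_def)
qed

lemma nclead_nonzero:
  assumes "p \<noteq> 0"
  shows "nclead p \<noteq> 0"
proof
  assume "nclead p = 0"
  have "ncdegree p \<in> insert 0 (Poly_Mapping.keys p)"
    unfolding ncdegree_def by (rule Max_in) auto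
  with \<open>nclead p = 0\<close> have "ncdegree p = 0"
    by (auto simp: nclead_def in_keys_iff)
  with \<open>nclead p = 0\<close> lead_at_ncdegree[of p] have "Poly_Mapping.lookup p k = 0" for k
    by (cases "k = 0") (auto simp: lead_at_def)
  with assms show False
    by (simp add: poly_mapping_eqI)
qed

lemma lead_at_of_rpoly: "lead_at (degree p) (of_rpoly p) (of_real (lead_coeff p))"
  by (auto simp: lead_at_def lookup_of_rpoly coeff_eq_0)

lemma lead_at_linear: "lead_at 1 (ncvar - ncconst h :: 'a :: ring_1 ncpoly) 1"
  by (auto simp: lead_at_def ncvar_def ncconst_def lookup_minus lookup_single when_def)

lemma lead_at_mult_cancel:
  fixes p q :: "'a :: ring_1 ncpoly"
  assumes "lead_at n (p * q) 1" "lead_at m q 1" "(0 :: 'a) \<noteq> 1"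
  shows "m \<le> n" "lead_at (n - m) p 1"
proof -
  have "p \<noteq> 0"
    using assms(1,3) by (auto simp: lead_at_def)
  have "lead_at (ncdegree p + m) (p * q) (nclead p)"
    using lead_at_mult[OF lead_at_ncdegree assms(2)] by simp
  then have "n = ncdegree p + m" "1 = nclead p"
    using lead_at_unique[OF assms(1)] assms(3) nclead_nonzero[OF \<open>p \<noteq> 0\<close>] by metis+
  then show "m \<le> n" "lead_at (n - m) p 1"
    using lead_at_ncdegree[of p] by auto
qed

section \<open>Complex roots of real polynomials\<close>

text \<open>The monic real polynomial with zeros \<open>s \<plusminus> m i\<close>; irreducible for \<open>m \<noteq> 0\<close>.\<close>

definition rquad :: "real \<Rightarrow> real \<Rightarrow> real poly" where
  "rquad s m = [:s\<^sup>2 + m\<^sup>2, - 2 * s, 1:]"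

lemma poly_rquad: "poly (rquad s m) x = (x - s)\<^sup>2 + m\<^sup>2"
  by (simp add: rquad_def power2_eq_square algebra_simps)

lemma rquad_nonzero [simp]: "rquad s m \<noteq> 0"
  by (simp add: rquad_def)

lemma degree_rquad [simp]: "degree (rquad s m) = 2"
  by (simp add: rquad_def)

lemma lead_coeff_rquad: "lead_coeff (rquad s m) = 1"
  by (simp add: rquad_def)

lemma complex_root_linear:
  assumes "poly (map_poly complex_of_real p) z = 0" "degree p < 2" "Im z \<noteq> 0"
  shows "p = 0"
proof -
  have p: "p = [:coeff p 0, coeff p 1:]"
    using assms(2) by (intro poly_eqI) (auto simp: coeff_pCons coeff_eq_0 split: nat.split)
  have "poly (map_poly complex_of_real [:coeff p 0, coeff p 1:]) z = 0"
    using assms(1) p by simp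
  then have "of_real (coeff p 0) + z * of_real (coeff p 1) = 0"
    by (simp add: map_poly_pCons)
  then have "coeff p 1 = 0" "coeff p 0 = 0"
    using assms(3) by (auto simp: complex_eq_iff)
  with p show ?thesis
    by simp
qed

lemma map_poly_complex_of_real_add:
  "map_poly complex_of_real (p + q) = map_poly complex_of_real p + map_poly complex_of_real q"
  by (rule poly_eqI) (simp add: coeff_map_poly)

lemma map_poly_complex_of_real_mult:
  "map_poly complex_of_real (p * q) = map_poly complex_of_real p * map_poly complex_of_real q"
  by (rule poly_eqI) (simp add: coeff_map_poly coeff_mult)

lemma map_poly_complex_of_real_diff:
  "map_poly complex_of_real (p - q) = map_poly complex_of_real p - map_poly complex_of_real q"
  by (rule poly_eqI) (simp add: coeff_map_poly)

lemma poly_rquad_complex_root: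
  "poly (map_poly complex_of_real (rquad (Re z) (Im z))) z = 0"
  by (simp add: rquad_def map_poly_pCons complex_eq_iff power2_eq_square algebra_simps)

lemma nonreal_root_mod:
  "poly (map_poly complex_of_real (p mod rquad (Re z) (Im z))) z = poly (map_poly complex_of_real p) z"
proof -
  have "poly (map_poly complex_of_real p) z
      = poly (map_poly complex_of_real (rquad (Re z) (Im z) * (p div rquad (Re z) (Im z))
          + p mod rquad (Re z) (Im z))) z"
    by simp
  also have "\<dots> = poly (map_poly complex_of_real (p mod rquad (Re z) (Im z))) z"
    by (simp only: map_poly_complex_of_real_add map_poly_complex_of_real_mult poly_add poly_mult
        poly_rquad_complex_root) simp
  finally show ?thesis ..
qed

lemma degree_mod_rquad: "degree (p mod rquad s m) < 2"
  using degree_mod_less[of "rquad s m" p] by (auto simp: rquad_nonzero)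

text \<open>The remainder modulo the quadratic has degree below 2 and still vanishes at \<open>z\<close>; as \<open>1\<close> and
  \<open>z\<close> are linearly independent over the reals, it is zero.\<close>

lemma rquad_dvd_if_nonreal_root:
  assumes "poly (map_poly complex_of_real p) z = 0" "Im z \<noteq> 0"
  shows "rquad (Re z) (Im z) dvd p"
  using complex_root_linear[OF _ degree_mod_rquad assms(2)] assms nonreal_root_mod[of p z]
  by (auto simp: mod_eq_0_iff_dvd)

lemma real_root_of_complex_root:
  assumes "poly (map_poly complex_of_real p) z = 0" "Im z = 0"
  shows "poly p (Re z) = 0"
proof -
  have "z = of_real (Re z)"
    using assms(2) by (simp add: complex_eq_iff)
  then have "poly (map_poly complex_of_real p) (of_real (Re z)) = 0"
    using assms(1) by simp
  moreover have "poly (map_poly complex_of_real p) (of_real x) = of_real (poly p x)" for x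
    by (induction p) (simp_all add: map_poly_pCons)
  ultimately show ?thesis
    by simp
qed

lemma complex_root_exists:
  assumes "degree p > 0"
  obtains z where "poly (map_poly complex_of_real p) z = 0"
proof -
  have "degree (map_poly complex_of_real p) > 0"
    using assms by (simp add: degree_map_poly)
  then have "\<not> constant (poly (map_poly complex_of_real p))"
    by (simp add: constant_degree)
  then show ?thesis
    using fundamental_theorem_of_algebra that by blast
qed

lemma real_poly_cases [consumes 1, case_names linear quadratic]:
  fixes p :: "real poly"
  assumes "degree p > 0"
  obtains r where "poly p r = 0"
  | z where "Im z \<noteq> 0" "poly (map_poly complex_of_real p) z = 0"
      "rquad (Re z) (Im z) dvd p"
  using complex_root_exists[OF assms] rquad_dvd_if_nonreal_root real_root_of_complex_root by metis

section \<open>Factorizability up to real multiples\<close>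

text \<open>
  The orthogonality hypothesis is the Study condition: it kills the dual part of \<open>h h\<^sup>*\<close>, while
  \<open>h + h\<^sup>*\<close> is real because the dual part of \<open>h\<close> is purely vectorial.
\<close>

lemma linear_motion_poly:
  assumes "a * x + b * y + c * z = 0"
  shows "motion_poly (ncvar - ncconst (Dual (Quat s a b c) (Quat 0 x y z)))"
proof -
  let ?h = "Dual (Quat s a b c) (Quat 0 x y z)"
  let ?N = "[:s\<^sup>2 + a\<^sup>2 + b\<^sup>2 + c\<^sup>2, - 2 * s, 1:]"
  have norm: "norm_poly (ncvar - ncconst ?h) = of_rpoly ?N"
    using assms
    by (intro dquat_ncpoly_eqI)
      (simp add: norm_poly_def of_real_dual of_real_quat dqcnj_def qcnj_def dual_ops quat_ops;
       simp add: power2_eq_square algebra_simps)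
  have "Poly_Mapping.lookup (of_rpoly ?N :: dquat ncpoly) 2 = 1"
    by (simp add: lookup_of_rpoly numeral_2_eq_2)
  then have "(of_rpoly ?N :: dquat ncpoly) \<noteq> 0"
    by auto
  with norm show ?thesis
    unfolding motion_poly_def by (metis rangeI)
qed

text \<open>
  The real multiplier \<open>D\<close> absorbs the leading coefficient, so the product may be required to be
  monic.
\<close>

definition factors_up_to_real :: "dquat ncpoly \<Rightarrow> bool" where
  "factors_up_to_real X \<longleftrightarrow> (\<exists>D :: real poly. \<exists>hs. D \<noteq> 0 \<and>
     X * of_rpoly D = prod_list (map (\<lambda>h. ncvar - ncconst h) hs) \<and>
     (\<forall>h\<in>set hs. motion_poly (ncvar - ncconst h)))"

lemma of_rpoly_mult: "of_rpoly (p * q) = (of_rpoly p * of_rpoly q :: dquat ncpoly)"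
  by (rule dquat_ncpoly_eqI) simp

lemma of_rpoly_commute: "of_rpoly p * X = X * (of_rpoly p :: dquat ncpoly)"
  by (rule dquat_ncpoly_eqI) (simp add: of_real_def)

lemma factors_mult:
  assumes "factors_up_to_real X" "factors_up_to_real Y"
  shows "factors_up_to_real (X * Y)"
proof -
  obtain D hs where X: "D \<noteq> 0" "X * of_rpoly D = prod_list (map (\<lambda>h. ncvar - ncconst h) hs)"
    "\<forall>h\<in>set hs. motion_poly (ncvar - ncconst h)"
    using assms(1) by (auto simp: factors_up_to_real_def)
  obtain E gs where Y: "E \<noteq> 0" "Y * of_rpoly E = prod_list (map (\<lambda>h. ncvar - ncconst h) gs)"
    "\<forall>h\<in>set gs. motion_poly (ncvar - ncconst h)"
    using assms(2) by (auto simp: factors_up_to_real_def)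
  have "X * Y * of_rpoly (D * E) = X * (Y * of_rpoly D) * of_rpoly E"
    by (simp only: of_rpoly_mult mult.assoc)
  also have "\<dots> = X * (of_rpoly D * Y) * of_rpoly E"
    by (simp only: of_rpoly_commute[of D Y])
  also have "\<dots> = (X * of_rpoly D) * (Y * of_rpoly E)"
    by (simp only: mult.assoc)
  also have "\<dots> = prod_list (map (\<lambda>h. ncvar - ncconst h) (hs @ gs))"
    using X Y by simp
  finally show ?thesis
    unfolding factors_up_to_real_def using X Y
    by (intro exI[of _ "D * E"] exI[of _ "hs @ gs"]) auto
qed

lemma factors_real_multD:
  assumes "factors_up_to_real (X * of_rpoly E)" "E \<noteq> 0"
  shows "factors_up_to_real X"
proof -
  obtain D hs where X: "D \<noteq> 0"
    "X * of_rpoly E * of_rpoly D = prod_list (map (\<lambda>h. ncvar - ncconst h) hs)"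
    "\<forall>h\<in>set hs. motion_poly (ncvar - ncconst h)"
    using assms(1) by (auto simp: factors_up_to_real_def)
  then show ?thesis
    unfolding factors_up_to_real_def using assms(2)
    by (intro exI[of _ "E * D"] exI[of _ hs]) (auto simp: of_rpoly_mult mult.assoc)
qed

lemma factors_linear:
  assumes "motion_poly (ncvar - ncconst h)"
  shows "factors_up_to_real (ncvar - ncconst h)"
proof -
  have "of_rpoly 1 = (1 :: dquat ncpoly)"
    by (rule dquat_ncpoly_eqI) simp
  then show ?thesis
    unfolding factors_up_to_real_def using assms
    by (intro exI[of _ 1] exI[of _ "[h]"]) simp
qed

lemma factors_linearI:
  assumes "\<And>x. ev X x = Dual (Quat (x - s) a b c) (Quat 0 e f g)"
    and "a * e + b * f + c * g = 0"
  shows "factors_up_to_real X"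
proof -
  have "X = ncvar - ncconst (Dual (Quat s (- a) (- b) (- c)) (Quat 0 (- e) (- f) (- g)))"
    using assms(1) by (intro dquat_ncpoly_eqI) (simp add: of_real_dual of_real_quat dual_ops quat_ops)
  also have "factors_up_to_real \<dots>"
    using assms(2) by (intro factors_linear linear_motion_poly) simp
  finally show ?thesis .
qed

lemma factors_rquad: "factors_up_to_real (of_rpoly (rquad s m))"
proof -
  let ?h = "Dual (Quat s m 0 0) (Quat 0 0 0 0)" and ?g = "Dual (Quat s (- m) 0 0) (Quat 0 0 0 0)"
  have "of_rpoly (rquad s m) = (ncvar - ncconst ?h) * (ncvar - ncconst ?g)"
    by (intro dquat_ncpoly_eqI)
      (simp add: poly_rquad of_real_dual of_real_quat dual_ops quat_ops power2_eq_square)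
  then show ?thesis
    by (simp add: factors_mult factors_linear linear_motion_poly)
qed

lemma factors_of_rpoly:
  assumes "E \<noteq> 0"
  shows "factors_up_to_real (of_rpoly E)"
  using assms
proof (induction "degree E" arbitrary: E rule: less_induct)
  case less
  show ?case
  proof (cases "degree E = 0")
    case True
    then obtain c where "E = [:c:]"
      using degree_0_id by metis
    with less.prems have "E * [:1 / c:] = 1"
      by (simp add: one_pCons)
    then have "of_rpoly E * of_rpoly [:1 / c:] = (1 :: dquat ncpoly)"
      unfolding of_rpoly_mult[symmetric] by (intro dquat_ncpoly_eqI) simp
    with \<open>E = [:c:]\<close> less.prems show ?thesis
      unfolding factors_up_to_real_def by (intro exI[of _ "[:1 / c:]"] exI[of _ "[]"]) auto
  next
    case False
    then have "degree E > 0" by simp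
    then show ?thesis
    proof (cases rule: real_poly_cases)
      case (linear r)
      then obtain F where F: "E = [:- r, 1:] * F"
        unfolding poly_eq_0_iff_dvd by (elim dvdE)
      with less.prems have "F \<noteq> 0"
        by auto
      then have "degree F < degree E"
        using F by (simp add: degree_mult_eq del: mult_pCons_left)
      moreover have "factors_up_to_real (of_rpoly [:- r, 1:])"
        by (rule factors_linearI[of _ r 0 0 0 0 0 0]) (simp_all add: of_real_dual of_real_quat quat_ops)
      ultimately show ?thesis
        using less.hyps \<open>F \<noteq> 0\<close> by (simp add: F of_rpoly_mult factors_mult del: mult_pCons_left)
    next
      case (quadratic z)
      then obtain F where F: "E = rquad (Re z) (Im z) * F"
        by (auto elim: dvdE)
      with less.prems have "F \<noteq> 0"
        by auto
      then have "degree F < degree E"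
        using F by (simp add: degree_mult_eq)
      then show ?thesis
        using less.hyps \<open>F \<noteq> 0\<close> by (simp add: F of_rpoly_mult factors_mult factors_rquad)
    qed
  qed
qed

section \<open>Translational motion polynomials\<close>

text \<open>The translation by the vector \<open>(a, b, c) / w\<close>, with denominators cleared.\<close>

definition translation :: "real poly \<Rightarrow> real poly \<Rightarrow> real poly \<Rightarrow> real poly \<Rightarrow> dquat ncpoly" where
  "translation w a b c = dual_poly (of_rpoly w) (qpoly 0 a b c)"

lemma ev_translation [simp]:
  "ev (translation w a b c) x
    = Dual (Quat (poly w x) 0 0 0) (Quat 0 (poly a x) (poly b x) (poly c x))"
  by (simp add: translation_def of_real_quat)

text \<open>
  Two translations with the same vector \<open>(a, b, c) / w\<close> have a common real multiple, so
  factorizability only depends on that vector.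
\<close>

lemma factors_translation_cong:
  assumes "factors_up_to_real (translation w a b c)" "w \<noteq> 0" "w' \<noteq> 0"
    and "a * w' = a' * w" "b * w' = b' * w" "c * w' = c' * w"
  shows "factors_up_to_real (translation w' a' b' c')"
proof -
  have eqs: "poly a x * poly w' x = poly a' x * poly w x" "poly b x * poly w' x = poly b' x * poly w x"
    "poly c x * poly w' x = poly c' x * poly w x" for x
    using assms(4-6) by (simp_all flip: poly_mult)
  have "translation w' a' b' c' * of_rpoly w = translation w a b c * of_rpoly w'"
    by (rule dquat_ncpoly_eqI) (simp add: of_real_dual of_real_quat dual_ops quat_ops eqs)
  moreover have "factors_up_to_real (translation w a b c * of_rpoly w')"
    using assms by (intro factors_mult factors_of_rpoly)
  ultimately show ?thesis
    using assms(2) factors_real_multD by metis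
qed

text \<open>
  As \<open>\<epsilon>\<^sup>2 = 0\<close>, the product of \<open>1 + \<epsilon> f\<close> and \<open>1 + \<epsilon> g\<close> is \<open>1 + \<epsilon> (f + g)\<close>.
\<close>

lemma factors_translation_add:
  assumes "factors_up_to_real (translation w a b c)" "factors_up_to_real (translation w a' b' c')"
    and "w \<noteq> 0"
  shows "factors_up_to_real (translation w (a + a') (b + b') (c + c'))"
proof -
  have "translation w a b c * translation w a' b' c'
      = translation w (a + a') (b + b') (c + c') * of_rpoly w"
    by (rule dquat_ncpoly_eqI)
      (simp add: of_real_dual of_real_quat dual_ops quat_ops algebra_simps)
  then show ?thesis
    using factors_mult[OF assms(1,2)] assms(3) factors_real_multD by metis
qed

text \<open>
  Quantifying over all constant vectors \<open>u\<close> in \<open>u g / w\<close> makes the admissible \<open>g\<close> a real vector space: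
  scaling \<open>g\<close> is the same as scaling \<open>u\<close>.
\<close>

definition factors_in_all_directions :: "real poly \<Rightarrow> real poly \<Rightarrow> bool" where
  "factors_in_all_directions w g \<longleftrightarrow>
     (\<forall>u1 u2 u3. factors_up_to_real (translation w (smult u1 g) (smult u2 g) (smult u3 g)))"

lemma directions_cong:
  assumes "factors_in_all_directions w g" "w \<noteq> 0" "w' \<noteq> 0" "g * w' = g' * w"
  shows "factors_in_all_directions w' g'"
  unfolding factors_in_all_directions_def
proof (intro allI)
  fix u1 u2 u3
  have "smult u g * w' = smult u g' * w" for u
    using assms(4) by simp
  then show "factors_up_to_real (translation w' (smult u1 g') (smult u2 g') (smult u3 g'))"
    using factors_translation_cong assms(1-3) unfolding factors_in_all_directions_def by blast
qed

lemma directions_add: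
  assumes "factors_in_all_directions w g" "factors_in_all_directions w h" "w \<noteq> 0"
  shows "factors_in_all_directions w (g + h)"
  using assms factors_translation_add
  unfolding factors_in_all_directions_def by (simp add: smult_add_right)

lemma directions_smult:
  assumes "factors_in_all_directions w g"
  shows "factors_in_all_directions w (smult k g)"
  using assms unfolding factors_in_all_directions_def by simp

lemma directions_zero:
  assumes "w \<noteq> 0"
  shows "factors_in_all_directions w 0"
proof -
  have "translation w 0 0 0 = of_rpoly w"
    by (rule dquat_ncpoly_eqI) (simp add: of_real_dual of_real_quat quat_ops)
  then show ?thesis
    using factors_of_rpoly[OF assms] by (simp add: factors_in_all_directions_def)
qed

lemma directions_simple_pole: "factors_in_all_directions [:- r, 1:] 1"
  unfolding factors_in_all_directions_def
proof (intro allI)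
  fix u1 u2 u3 :: real
  show "factors_up_to_real (translation [:- r, 1:] (smult u1 1) (smult u2 1) (smult u3 1))"
    by (rule factors_linearI[of _ r 0 0 0 u1 u2 u3]) simp_all
qed

lemma unit_orthogonal_exists:
  obtains e1 e2 e3 :: real where "e1\<^sup>2 + e2\<^sup>2 + e3\<^sup>2 = 1" "e1 * u1 + e2 * u2 + e3 * u3 = 0"
proof (cases "u1 = 0 \<and> u2 = 0")
  case True
  then show ?thesis
    by (intro that[of 1 0 0]) simp_all
next
  case False
  define n where "n = sqrt (u1\<^sup>2 + u2\<^sup>2)"
  have n: "n\<^sup>2 = u1\<^sup>2 + u2\<^sup>2" "n \<noteq> 0"
    using False by (auto simp: n_def sum_power2_eq_zero_iff)
  show ?thesis
  proof (rule that[of "- u2 / n" "u1 / n" 0])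
    have "(- u2 / n)\<^sup>2 + (u1 / n)\<^sup>2 + 0\<^sup>2 = (u1\<^sup>2 + u2\<^sup>2) / n\<^sup>2"
      by (simp add: power_divide add_divide_distrib)
    then show "(- u2 / n)\<^sup>2 + (u1 / n)\<^sup>2 + 0\<^sup>2 = 1"
      using n(2) unfolding n(1)[symmetric] by simp
  qed simp
qed

text \<open>
  With \<open>u\<close> orthogonal to the unit vector \<open>e\<close>, the product \<open>(t - s - m e) (t - s + m e + \<epsilon> u)\<close> has two
  linear motion polynomial factors and equals \<open>N + \<epsilon> ((t - s) u - m (e \<times> u))\<close>. The three
  coordinates in the statement are those of \<open>(t - s) u - m (e \<times> u)\<close>.
\<close>

lemma circular_translation:
  assumes e: "e1\<^sup>2 + e2\<^sup>2 + e3\<^sup>2 = (1 :: real)" "e1 * u1 + e2 * u2 + e3 * u3 = 0"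
  shows "factors_up_to_real (translation (rquad s m)
    [:- s * u1 - m * (e2 * u3 - e3 * u2), u1:]
    [:- s * u2 - m * (e3 * u1 - e1 * u3), u2:]
    [:- s * u3 - m * (e1 * u2 - e2 * u1), u3:])" (is "factors_up_to_real ?T")
proof -
  let ?h = "Dual (Quat s (m * e1) (m * e2) (m * e3)) (Quat 0 0 0 0)"
  let ?g = "Dual (Quat s (- m * e1) (- m * e2) (- m * e3)) (Quat 0 (- u1) (- u2) (- u3))"
  have m2: "m * m * (e1 * e1) + m * m * (e2 * e2) + m * m * (e3 * e3) = m * m"
    using e(1) by (simp add: power2_eq_square flip: distrib_left)
  have mu: "m * e1 * u1 + m * e2 * u2 + m * e3 * u3 = 0"
    using e(2) by (simp add: mult.assoc flip: distrib_left)
  have "?T = (ncvar - ncconst ?h) * (ncvar - ncconst ?g)"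
    using m2 mu by (intro dquat_ncpoly_eqI)
      (simp add: poly_rquad of_real_dual of_real_quat dual_ops quat_ops; simp add: power2_eq_square algebra_simps)
  moreover have "motion_poly (ncvar - ncconst ?h)" "motion_poly (ncvar - ncconst ?g)"
    using mu by (auto intro!: linear_motion_poly)
  ultimately show ?thesis
    by (simp add: factors_mult factors_linear)
qed

text \<open>
  Adding the circular translations for \<open>e\<close> and \<open>-e\<close> cancels the cross product and leaves
  \<open>2 (t - s) u / N\<close>.
\<close>

lemma directions_linear_over_quadratic: "factors_in_all_directions (rquad s m) [:- s, 1:]"
  unfolding factors_in_all_directions_def
proof (intro allI)
  fix v1 v2 v3 :: real
  define u1 u2 u3 where "u1 = v1 / 2" "u2 = v2 / 2" "u3 = v3 / 2"
  obtain e1 e2 e3 where e: "e1\<^sup>2 + e2\<^sup>2 + e3\<^sup>2 = 1" "e1 * u1 + e2 * u2 + e3 * u3 = 0"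
    using unit_orthogonal_exists by blast
  have e': "(- e1)\<^sup>2 + (- e2)\<^sup>2 + (- e3)\<^sup>2 = 1" "- e1 * u1 + - e2 * u2 + - e3 * u3 = 0"
    using e by simp_all
  show "factors_up_to_real (translation (rquad s m)
      (smult v1 [:- s, 1:]) (smult v2 [:- s, 1:]) (smult v3 [:- s, 1:]))"
    using factors_translation_add[OF circular_translation[OF e, of s m]
        circular_translation[OF e', of s m]]
    by (simp add: u1_u2_u3_def algebra_simps)
qed

text \<open>
  Adding the circular translations for \<open>(e, u)\<close> and \<open>(-e, -u)\<close> instead leaves \<open>-2 m (e \<times> u) / N\<close>.
  Given the target vector \<open>v\<close>, the choice \<open>u = (e \<times> v) / (2 m)\<close> with \<open>e\<close> orthogonal to \<open>v\<close> works,
  because \<open>e \<times> (e \<times> v) = - v\<close>.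
\<close>

lemma directions_const_over_quadratic:
  assumes "m \<noteq> 0"
  shows "factors_in_all_directions (rquad s m) 1"
  unfolding factors_in_all_directions_def
proof (intro allI)
  fix v1 v2 v3 :: real
  obtain e1 e2 e3 where e: "e1\<^sup>2 + e2\<^sup>2 + e3\<^sup>2 = 1" "e1 * v1 + e2 * v2 + e3 * v3 = 0"
    using unit_orthogonal_exists by blast
  define k where "k = 1 / (2 * m)"
  define u1 u2 u3 where "u1 = k * (e2 * v3 - e3 * v2)" "u2 = k * (e3 * v1 - e1 * v3)"
    "u3 = k * (e1 * v2 - e2 * v1)"
  have e': "(- e1)\<^sup>2 + (- e2)\<^sup>2 + (- e3)\<^sup>2 = 1"
    using e by simp
  have perp: "e1 * u1 + e2 * u2 + e3 * u3 = 0" "- e1 * - u1 + - e2 * - u2 + - e3 * - u3 = 0"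
    unfolding u1_u2_u3_def by (simp_all add: algebra_simps)
  have cross: "e2 * u3 - e3 * u2 = - k * v1" "e3 * u1 - e1 * u3 = - k * v2"
    "e1 * u2 - e2 * u1 = - k * v3"
    using e unfolding u1_u2_u3_def by algebra+
  have cross': "- e2 * - u3 - - e3 * - u2 = - k * v1" "- e3 * - u1 - - e1 * - u3 = - k * v2"
    "- e1 * - u2 - - e2 * - u1 = - k * v3"
    using cross by simp_all
  have k: "m * (k * v) * 2 = v" for v
    using assms by (simp add: k_def)
  have "factors_up_to_real (translation (rquad s m) [:m * (k * v1) * 2:] [:m * (k * v2) * 2:] [:m * (k * v3) * 2:])"
    using factors_translation_add[OF circular_translation[OF e(1) perp(1), of s m, unfolded cross]
        circular_translation[OF e' perp(2), of s m, unfolded cross']]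
    by (simp add: algebra_simps)
  then show "factors_up_to_real (translation (rquad s m) (smult v1 1) (smult v2 1) (smult v3 1))"
    unfolding k by (simp add: one_pCons)
qed

text \<open>
  Multiplying \<open>w + \<epsilon> u g\<close> by \<open>t - s - m e\<close> from the left and by \<open>t - s + m e\<close> from the right keeps
  it factorizable. It turns the primal part into \<open>w N\<close> and, for \<open>u\<close> orthogonal to \<open>e\<close>, the vector
  \<open>u\<close> into \<open>((t - s)\<^sup>2 - m\<^sup>2) u - 2 m (t - s) (e \<times> u)\<close>.
\<close>

lemma conjugate_translation:
  assumes e: "e1\<^sup>2 + e2\<^sup>2 + e3\<^sup>2 = (1 :: real)" "e1 * u1 + e2 * u2 + e3 * u3 = 0"
    and "factors_up_to_real (translation w (smult u1 g) (smult u2 g) (smult u3 g))"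
  shows "factors_up_to_real (translation (w * rquad s m)
    (g * (smult u1 ([:- s, 1:]\<^sup>2 - [:m\<^sup>2:]) - smult (2 * m * (e2 * u3 - e3 * u2)) [:- s, 1:]))
    (g * (smult u2 ([:- s, 1:]\<^sup>2 - [:m\<^sup>2:]) - smult (2 * m * (e3 * u1 - e1 * u3)) [:- s, 1:]))
    (g * (smult u3 ([:- s, 1:]\<^sup>2 - [:m\<^sup>2:]) - smult (2 * m * (e1 * u2 - e2 * u1)) [:- s, 1:])))"
    (is "factors_up_to_real ?T")
proof -
  let ?h = "\<lambda>m. Dual (Quat s (m * e1) (m * e2) (m * e3)) (Quat 0 0 0 0)"
  have "?T = (ncvar - ncconst (?h m)) * (translation w (smult u1 g) (smult u2 g) (smult u3 g)
      * (ncvar - ncconst (?h (- m))))" (is "_ = ?R")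
  proof (rule dquat_ncpoly_eqI)
    fix x
    define y W G where "y = x - s" "W = poly w x" "G = poly g x"
    have T': "ev ?T x = Dual (Quat (W * (y\<^sup>2 + m\<^sup>2)) 0 0 0)
       (Quat 0 (G * (u1 * (y\<^sup>2 - m\<^sup>2) - 2 * m * (e2 * u3 - e3 * u2) * y))
         (G * (u2 * (y\<^sup>2 - m\<^sup>2) - 2 * m * (e3 * u1 - e1 * u3) * y))
         (G * (u3 * (y\<^sup>2 - m\<^sup>2) - 2 * m * (e1 * u2 - e2 * u1) * y)))"
      by (simp add: y_W_G_def poly_rquad) (simp add: algebra_simps)
    have L: "ev (ncvar - ncconst (?h m)) x = Dual (Quat y (- m * e1) (- m * e2) (- m * e3)) 0" for m
      by (simp add: y_W_G_def of_real_dual of_real_quat dual_ops quat_ops)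
    have T: "ev (translation w (smult u1 g) (smult u2 g) (smult u3 g)) x
        = Dual (Quat W 0 0 0) (Quat 0 (u1 * G) (u2 * G) (u3 * G))"
      by (simp add: y_W_G_def)
    have R: "ev ?R x = Dual (Quat y (- m * e1) (- m * e2) (- m * e3)) 0 *
        (Dual (Quat W 0 0 0) (Quat 0 (u1 * G) (u2 * G) (u3 * G)) *
         Dual (Quat y (- (- m) * e1) (- (- m) * e2) (- (- m) * e3)) 0)"
      unfolding ev_mult L T ..
    define K where "K = Quat y (- m * e1) (- m * e2) (- m * e3)
      * (Quat 0 (u1 * G) (u2 * G) (u3 * G) * Quat y (m * e1) (m * e2) (m * e3))"
    note K = K_def[unfolded times_quat_def quat.sel]
    have "W * (y\<^sup>2 + m\<^sup>2) = y * (W * y) + m * e1 * (W * (m * e1)) + m * e2 * (W * (m * e2))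
        + m * e3 * (W * (m * e3))"
      using e(1) by algebra
    moreover have "G * (u1 * (y\<^sup>2 - m\<^sup>2) - 2 * m * (e2 * u3 - e3 * u2) * y) = qIm1 K"
      using e unfolding K quat.sel by algebra
    moreover have "G * (u2 * (y\<^sup>2 - m\<^sup>2) - 2 * m * (e3 * u1 - e1 * u3) * y) = qIm2 K"
      using e unfolding K quat.sel by algebra
    moreover have "G * (u3 * (y\<^sup>2 - m\<^sup>2) - 2 * m * (e1 * u2 - e2 * u1) * y) = qIm3 K"
      using e unfolding K quat.sel by algebra
    moreover have "0 = qRe K"
      by (simp add: K_def times_quat_def algebra_simps)
    ultimately show "ev ?T x = ev ?R x"
      unfolding R T' by (simp add: K_def dual_eq_iff quat_eq_iff dual_ops quat_ops)
  qed
  moreover have "motion_poly (ncvar - ncconst (?h m))" for m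
    by (auto intro!: linear_motion_poly)
  ultimately show ?thesis
    using assms(3) by (simp only: factors_mult factors_linear)
qed

text \<open>
  The step that raises the order of a nonreal pole. The conjugates by \<open>e\<close> and \<open>-e\<close> add up to
  \<open>2 ((t - s)\<^sup>2 - m\<^sup>2) u g / (w N) = 2 (N - 2 m\<^sup>2) u g / (w N)\<close>. Subtracting this from twice the
  original \<open>u g / w = N u g / (w N)\<close> isolates the multiple \<open>4 m\<^sup>2\<close> of \<open>u g / (w N)\<close>.
\<close>

lemma directions_times_quadratic:
  assumes "factors_in_all_directions w g" "w \<noteq> 0" "m \<noteq> 0"
  shows "factors_in_all_directions (w * rquad s m) g"
proof -
  let ?N = "rquad s m"
  have nz: "w * ?N \<noteq> 0"
    using assms(2) by simp
  have N: "?N - [:2 * m\<^sup>2:] = [:- s, 1:]\<^sup>2 - [:m\<^sup>2:]"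
    by (simp add: rquad_def power2_eq_square)
  have "factors_in_all_directions (w * ?N) (g * (?N - [:2 * m\<^sup>2:]))"
    unfolding factors_in_all_directions_def
  proof (intro allI)
    fix v1 v2 v3 :: real
    define u1 u2 u3 where "u1 = v1 / 2" "u2 = v2 / 2" "u3 = v3 / 2"
    have f: "factors_up_to_real (translation w (smult u1 g) (smult u2 g) (smult u3 g))"
      using assms(1) by (simp add: factors_in_all_directions_def)
    obtain e1 e2 e3 where e: "e1\<^sup>2 + e2\<^sup>2 + e3\<^sup>2 = 1" "e1 * u1 + e2 * u2 + e3 * u3 = 0"
      using unit_orthogonal_exists by blast
    have e': "(- e1)\<^sup>2 + (- e2)\<^sup>2 + (- e3)\<^sup>2 = 1" "- e1 * u1 + - e2 * u2 + - e3 * u3 = 0"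
      using e by simp_all
    have sum: "g * (smult (v / 2) q - smult (2 * m * (a * b - c * d)) l)
          + g * (smult (v / 2) q - smult (2 * m * (- a * b - - c * d)) l) = smult v (g * q)"
      for v a b c d :: real and q l
      by (rule poly_ext) (simp add: algebra_simps)
    show "factors_up_to_real (translation (w * ?N) (smult v1 (g * (?N - [:2 * m\<^sup>2:])))
        (smult v2 (g * (?N - [:2 * m\<^sup>2:]))) (smult v3 (g * (?N - [:2 * m\<^sup>2:]))))"
      using factors_translation_add[OF conjugate_translation[OF e f, of s m]
          conjugate_translation[OF e' f, of s m] nz]
      unfolding N u1_u2_u3_def sum .
  qed
  moreover have "factors_in_all_directions (w * ?N) (g * ?N)"
    using assms nz by (intro directions_cong[OF assms(1)]) (auto simp: mult_ac)
  ultimately have "factors_in_all_directions (w * ?N)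
      (smult (1 / (2 * m\<^sup>2)) (g * ?N + smult (- 1) (g * (?N - [:2 * m\<^sup>2:]))))"
    using nz by (intro directions_smult directions_add)
  moreover have "smult (1 / (2 * m\<^sup>2)) (g * ?N + smult (- 1) (g * (?N - [:2 * m\<^sup>2:]))) = g"
    using assms(3) by (intro poly_ext) (simp add: algebra_simps)
  ultimately show ?thesis
    by simp
qed

lemma directions_quadratic_power:
  assumes "m \<noteq> 0" "degree h < 2"
  shows "factors_in_all_directions (rquad s m ^ Suc k) h"
proof (induction k)
  case 0
  have "h = smult (coeff h 1) [:- s, 1:] + smult (coeff h 0 + coeff h 1 * s) 1"
    using assms(2) by (intro poly_eqI) (auto simp: coeff_pCons coeff_eq_0 split: nat.split)
  moreover have "factors_in_all_directions (rquad s m)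
      (smult (coeff h 1) [:- s, 1:] + smult (coeff h 0 + coeff h 1 * s) 1)"
    using assms(1) by (intro directions_add directions_smult directions_const_over_quadratic
        directions_linear_over_quadratic) simp_all
  ultimately show ?case
    by simp
next
  case (Suc k)
  then have "factors_in_all_directions (rquad s m ^ Suc k * rquad s m) h"
    using assms(1) by (intro directions_times_quadratic) simp_all
  then show ?case
    by (simp only: power_Suc2[of _ "Suc k"])
qed

text \<open>
  Partial fractions, splitting off one pole at a time: at a simple real zero \<open>r\<close> of \<open>w\<close> the
  summand \<open>c / (t - r)\<close>, at a nonreal zero of multiplicity \<open>k + 1\<close> a summand \<open>h / N\<^bsup>k+1\<^esup>\<close> with \<open>h\<close>
  of degree below 2. In both cases the remaining fraction has a denominator of smaller degree.
\<close>

lemma directions_simple_real_poles: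
  assumes "w \<noteq> 0" "\<And>r. \<not> [:- r, 1:]\<^sup>2 dvd w" "g = 0 \<or> degree g < degree w"
  shows "factors_in_all_directions w g"
  using assms
proof (induction "degree w" arbitrary: w g rule: less_induct)
  case less
  show ?case
  proof (cases "degree w = 0")
    case True
    with less.prems show ?thesis
      by (auto intro: directions_zero)
  next
    case False
    then have "degree w > 0" by simp
    then show ?thesis
    proof (cases rule: real_poly_cases)
      case (linear r)
      let ?L = "[:- r, 1:]"
      obtain F where F: "w = ?L * F"
        using linear unfolding poly_eq_0_iff_dvd by (elim dvdE)
      have "F \<noteq> 0"
        using F less.prems(1) by auto
      have dw: "degree w = Suc (degree F)"
        using F \<open>F \<noteq> 0\<close> by (simp add: degree_mult_eq del: mult_pCons_left)
      have "\<not> ?L dvd F"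
        using less.prems(2)[of r] mult_dvd_mono[OF dvd_refl[of ?L], of ?L F]
        unfolding F power2_eq_square by blast
      then have "poly F r \<noteq> 0"
        by (simp add: poly_eq_0_iff_dvd)
      \<comment> \<open>The residue of \<open>g / w\<close> at the simple pole \<open>r\<close>.\<close>
      define c where "c = poly g r / poly F r"
      have "poly (g - smult c F) r = 0"
        using \<open>poly F r \<noteq> 0\<close> by (simp add: c_def)
      then obtain g' where g': "g - smult c F = ?L * g'"
        unfolding poly_eq_0_iff_dvd by (elim dvdE)
      have "degree g \<le> degree F"
        using less.prems(3) dw by auto
      then have "degree (?L * g') \<le> degree F"
        unfolding g'[symmetric] by (intro degree_diff_le) (auto intro: order_trans[OF degree_smult_le])
      then have "g' = 0 \<or> degree g' < degree F"
        by (cases "g' = 0") (simp_all add: degree_mult_eq del: mult_pCons_left)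
      moreover have "\<not> [:- q, 1:]\<^sup>2 dvd F" for q
        using less.prems(2)[of q] F by (auto simp del: mult_pCons_left)
      ultimately have "factors_in_all_directions F g'"
        using less.hyps[of F g'] dw \<open>F \<noteq> 0\<close> by simp
      then have 1: "factors_in_all_directions w (?L * g')"
        using \<open>F \<noteq> 0\<close> less.prems(1) by (rule directions_cong) (simp only: F mult_ac)
      have "factors_in_all_directions ?L (smult c 1)"
        by (intro directions_smult directions_simple_pole)
      then have 2: "factors_in_all_directions w (smult c F)"
        by (rule directions_cong[OF _ _ less.prems(1)])
          (simp, simp only: F mult_smult_left mult_smult_right mult_1_left mult_ac)
      have "g = ?L * g' + smult c F"
        by (simp only: g'[symmetric] diff_add_cancel)
      with directions_add[OF 1 2 less.prems(1)] show ?thesis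
        by simp
    next
      case (quadratic z)
      let ?N = "rquad (Re z) (Im z)" and ?c = "map_poly complex_of_real"
      have "\<not> is_unit ?N"
        by (simp add: is_unit_iff_degree)
      then obtain F where F: "w = ?N ^ multiplicity ?N w * F" "\<not> ?N dvd F"
        using multiplicity_decompose'[of w ?N] less.prems(1) by metis
      have "multiplicity ?N w \<noteq> 0"
        using F quadratic by (metis mult_1 power_0)
      then obtain k where k: "multiplicity ?N w = Suc k"
        using not0_implies_Suc by blast
      define w' where "w' = ?N ^ k * F"
      have w: "w = ?N * w'" "w = ?N ^ Suc k * F"
        using F k by (simp_all add: w'_def)
      have nz: "F \<noteq> 0" "w' \<noteq> 0"
        using w less.prems(1) by auto
      have dw: "degree w = degree w' + 2" "degree w \<ge> degree F + 2"
        using w(1) nz by (auto simp: degree_mult_eq w'_def)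
      have "poly (?c F) z \<noteq> 0"
        using F(2) rquad_dvd_if_nonreal_root quadratic(1) by blast
      \<comment> \<open>The real linear polynomial \<open>h\<close> with \<open>h(z) = g(z) / F(z)\<close> makes \<open>g - h F\<close> vanish at \<open>z\<close>.\<close>
      define v where "v = poly (?c g) z / poly (?c F) z"
      define al where "al = Im v / Im z"
      define h where "h = [:Re v - al * Re z, al:]"
      have "poly (?c h) z = v"
        using quadratic(1) by (simp add: h_def al_def map_poly_pCons complex_eq_iff)
      then have "poly (?c (g - h * F)) z = 0"
        using \<open>poly (?c F) z \<noteq> 0\<close>
        by (simp add: map_poly_complex_of_real_diff map_poly_complex_of_real_mult v_def)
      then obtain g' where g': "g - h * F = ?N * g'"
        using rquad_dvd_if_nonreal_root quadratic(1) by (metis dvdE)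
      have "degree h < 2"
        by (simp add: h_def)
      then have "degree (h * F) < degree w"
        using degree_mult_le[of h F] dw by linarith
      moreover have "degree g < degree w"
        using less.prems(3) False by auto
      ultimately have "degree (?N * g') < degree w"
        unfolding g'[symmetric] by (rule degree_diff_less[rotated])
      then have "g' = 0 \<or> degree g' < degree w'"
        using dw by (cases "g' = 0") (simp_all add: degree_mult_eq)
      moreover have "\<not> [:- q, 1:]\<^sup>2 dvd w'" for q
        using less.prems(2)[of q] w(1) by auto
      ultimately have "factors_in_all_directions w' g'"
        using less.hyps[of w' g'] dw nz by simp
      then have 1: "factors_in_all_directions w (?N * g')"
        using nz(2) less.prems(1) by (rule directions_cong) (simp add: w(1) mult_ac)
      have "factors_in_all_directions (?N ^ Suc k) h"
        using quadratic(1) \<open>degree h < 2\<close> by (rule directions_quadratic_power)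
      then have 2: "factors_in_all_directions w (h * F)"
        by (rule directions_cong[OF _ _ less.prems(1)]) (simp_all add: w(2) mult_ac)
      have "g = ?N * g' + h * F"
        by (simp only: g'[symmetric] diff_add_cancel)
      with directions_add[OF 1 2 less.prems(1)] show ?thesis
        by simp
    qed
  qed
qed

lemma factors_translation_simple_real_poles:
  assumes "w \<noteq> 0" "\<And>r. \<not> [:- r, 1:]\<^sup>2 dvd w"
    and "a = 0 \<or> degree a < degree w" "b = 0 \<or> degree b < degree w" "c = 0 \<or> degree c < degree w"
  shows "factors_up_to_real (translation w a b c)"
proof -
  have "factors_up_to_real (translation w (smult u1 g) (smult u2 g) (smult u3 g))"
    if "g = 0 \<or> degree g < degree w" for u1 u2 u3 g
    using directions_simple_real_poles[OF assms(1,2) that] by (simp add: factors_in_all_directions_def)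
  then have "factors_up_to_real (translation w (smult 1 a + smult 0 b + smult 0 c)
     (smult 0 a + smult 1 b + smult 0 c) (smult 0 a + smult 0 b + smult 1 c))"
    using assms by (intro factors_translation_add) blast+
  then show ?thesis
    by simp
qed

section \<open>Factorization of quaternionic polynomials\<close>

lemma dual_poly_mult_primal: "dual_poly (P * R) 0 = dual_poly P 0 * dual_poly R 0"
  by (rule dquat_ncpoly_eqI) (simp add: dual_ops)

lemma dual_poly_of_rpoly: "dual_poly (of_rpoly E) 0 = of_rpoly E"
  by (rule dquat_ncpoly_eqI) (simp add: of_real_dual)

lemma lead_at_qpoly:
  assumes "lead_at n (qpoly a b c d) 1"
  shows "degree a = n" "b = 0 \<or> degree b < n" "c = 0 \<or> degree c < n"
    "d = 0 \<or> degree d < n"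
proof -
  have n: "coeff a n = 1" "coeff b n = 0" "coeff c n = 0" "coeff d n = 0"
    and above: "\<And>k. k > n \<Longrightarrow> coeff a k = 0 \<and> coeff b k = 0 \<and> coeff c k = 0 \<and> coeff d k = 0"
    using assms by (auto simp: lead_at_def lookup_qpoly quat_ops)
  show "degree a = n"
    using n above by (intro antisym degree_le le_degree) auto
  have *: "p = 0 \<or> degree p < n" if "coeff p n = 0" "\<And>k. k > n \<Longrightarrow> coeff p k = 0" for p :: "real poly"
  proof -
    have "degree p \<noteq> n" if "p \<noteq> 0"
      using that \<open>coeff p n = 0\<close> by auto
    moreover have "degree p \<le> n"
      using that by (intro degree_le) auto
    ultimately show ?thesis
      by fastforce
  qed
  show "b = 0 \<or> degree b < n" "c = 0 \<or> degree c < n" "d = 0 \<or> degree d < n"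
    using *[of b] *[of c] *[of d] n above by blast+
qed

text \<open>The norm \<open>\<nu>(P)\<close> of \<open>P = a + b i + c j + d k\<close>.\<close>

definition norm_rpoly :: "real poly \<Rightarrow> real poly \<Rightarrow> real poly \<Rightarrow> real poly \<Rightarrow> real poly" where
  "norm_rpoly a b c d = a\<^sup>2 + b\<^sup>2 + c\<^sup>2 + d\<^sup>2"

lemma degree_square_less:
  assumes "p = 0 \<or> degree p < n" "n > 0"
  shows "degree (p\<^sup>2 :: real poly) < 2 * n"
  using assms degree_power_le[of p 2] by (auto simp: power2_eq_square)

lemma degree_norm_rpoly:
  assumes "degree a = n" "n > 0" "b = 0 \<or> degree b < n" "c = 0 \<or> degree c < n"
    "d = 0 \<or> degree d < n"
  shows "degree (norm_rpoly a b c d) = 2 * n"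
proof -
  have "degree (b\<^sup>2 + (c\<^sup>2 + d\<^sup>2)) < 2 * n"
    using assms by (intro degree_add_less degree_square_less)
  moreover have "degree (a\<^sup>2) = 2 * n"
    unfolding power2_eq_square using assms(1,2) by (subst degree_mult_eq) auto
  ultimately have "degree (a\<^sup>2 + (b\<^sup>2 + (c\<^sup>2 + d\<^sup>2))) = 2 * n"
    using degree_add_eq_left by metis
  then show ?thesis
    by (simp add: norm_rpoly_def add.assoc)
qed

lemma norm_rpoly_root:
  "poly (norm_rpoly a b c d) r = 0 \<longleftrightarrow> poly a r = 0 \<and> poly b r = 0 \<and> poly c r = 0 \<and> poly d r = 0"
  by (auto simp: norm_rpoly_def add_nonneg_eq_0_iff)

lemma common_dvd_qpoly:
  assumes "E dvd a" "E dvd b" "E dvd c" "E dvd d"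
  shows "qpoly a b c d = qpoly (a div E) (b div E) (c div E) (d div E) * of_rpoly E"
proof (rule quat_ncpoly_eqI)
  fix x
  have "poly p x = poly (p div E) x * poly E x" if "E dvd p" for p
    using that by (metis dvd_div_mult_self poly_mult)
  from this[OF assms(1)] this[OF assms(2)] this[OF assms(3)] this[OF assms(4)]
  show "ev (qpoly a b c d) x
      = ev (qpoly (a div E) (b div E) (c div E) (d div E) * of_rpoly E) x"
    by (simp add: of_real_quat quat_ops)
qed

text \<open>
  For real quadruples \<open>\<alpha>\<close> and \<open>\<beta>\<close>, the sum of squares of the coordinates of \<open>\<beta> + z \<alpha>\<close> is
  \<open>|\<beta>|\<^sup>2 + 2 z \<langle>\<alpha>, \<beta>\<rangle> + z\<^sup>2 |\<alpha>|\<^sup>2\<close>. If it vanishes at a nonreal \<open>z\<close>, comparison with the real quadratic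
  with zero \<open>z\<close> gives \<open>\<langle>\<alpha>, \<beta>\<rangle>\<close> and \<open>|\<beta>|\<^sup>2\<close>.
\<close>

lemma isotropic_linear_poly_relations:
  fixes a0 a1 b0 b1 c0 c1 d0 d1 :: real
  assumes "(of_real a0 + z * of_real a1)\<^sup>2 + (of_real b0 + z * of_real b1)\<^sup>2
      + (of_real c0 + z * of_real c1)\<^sup>2 + (of_real d0 + z * of_real d1)\<^sup>2 = 0"
    and "Im z \<noteq> 0"
  shows "a0 * a1 + b0 * b1 + c0 * c1 + d0 * d1 = - Re z * (a1\<^sup>2 + b1\<^sup>2 + c1\<^sup>2 + d1\<^sup>2)"
    and "a0\<^sup>2 + b0\<^sup>2 + c0\<^sup>2 + d0\<^sup>2 = ((Re z)\<^sup>2 + (Im z)\<^sup>2) * (a1\<^sup>2 + b1\<^sup>2 + c1\<^sup>2 + d1\<^sup>2)"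
proof -
  define x y where "x = Re z" "y = Im z"
  have "2 * y * (a0 * a1 + b0 * b1 + c0 * c1 + d0 * d1 + x * (a1\<^sup>2 + b1\<^sup>2 + c1\<^sup>2 + d1\<^sup>2)) = 0"
    using arg_cong[OF assms(1), of Im]
    by (simp add: x_y_def power2_eq_square algebra_simps)
  then show 1: "a0 * a1 + b0 * b1 + c0 * c1 + d0 * d1 = - Re z * (a1\<^sup>2 + b1\<^sup>2 + c1\<^sup>2 + d1\<^sup>2)"
    using assms(2) by (simp add: x_y_def)
  have "a0\<^sup>2 + b0\<^sup>2 + c0\<^sup>2 + d0\<^sup>2 + 2 * x * (a0 * a1 + b0 * b1 + c0 * c1 + d0 * d1)
      + (x\<^sup>2 - y\<^sup>2) * (a1\<^sup>2 + b1\<^sup>2 + c1\<^sup>2 + d1\<^sup>2) = 0"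
    using arg_cong[OF assms(1), of Re]
    by (simp add: x_y_def power2_eq_square algebra_simps)
  then show "a0\<^sup>2 + b0\<^sup>2 + c0\<^sup>2 + d0\<^sup>2 = ((Re z)\<^sup>2 + (Im z)\<^sup>2) * (a1\<^sup>2 + b1\<^sup>2 + c1\<^sup>2 + d1\<^sup>2)"
    unfolding 1 x_y_def by algebra
qed

text \<open>
  Let \<open>P = a + b i + c j + d k\<close>, and let \<open>N\<close> be the monic real quadratic with zero \<open>z\<close>. The
  remainder of \<open>P\<close> modulo \<open>N\<close> is \<open>\<alpha> t + \<beta>\<close>, and its norm vanishes at \<open>z\<close>, hence is a
  constant multiple of \<open>N\<close>. If \<open>\<alpha>\<close> were zero then so would be \<open>\<beta>\<close>, and \<open>N\<close> would divide \<open>P\<close>.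
  Therefore \<open>h = - \<alpha>\<^sup>-\<^sup>1 \<beta>\<close> exists and satisfies \<open>(t - h\<^sup>*) (t - h) = N\<close>, so that \<open>t - h\<close> is
  a right factor of both \<open>N\<close> and \<open>\<alpha> t + \<beta> = \<alpha> (t - h)\<close>, hence of \<open>P\<close>.
\<close>

lemma linear_right_factor:
  assumes "poly (map_poly complex_of_real (norm_rpoly a b c d)) z = 0" "Im z \<noteq> 0"
    and "\<not> (rquad (Re z) (Im z) dvd a \<and> rquad (Re z) (Im z) dvd b
      \<and> rquad (Re z) (Im z) dvd c \<and> rquad (Re z) (Im z) dvd d)"
  obtains R h where "qpoly a b c d = R * (ncvar - ncconst h)"
proof -
  let ?N = "rquad (Re z) (Im z)" and ?c = "map_poly complex_of_real"
  define x y where "x = Re z" "y = Im z"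
  define r0 r1 where "r0 p = coeff (p mod ?N) 0" "r1 p = coeff (p mod ?N) 1" for p
  have rem: "p mod ?N = [:r0 p, r1 p:]" for p
    using degree_mod_rquad[of p "Re z" "Im z"]
    by (intro poly_eqI) (auto simp: r0_r1_def coeff_pCons coeff_eq_0 split: nat.split)
  have "poly (?c p) z = of_real (r0 p) + z * of_real (r1 p)" for p
    using nonreal_root_mod[of p z] by (simp add: rem map_poly_pCons)
  then have "(of_real (r0 a) + z * of_real (r1 a))\<^sup>2 + (of_real (r0 b) + z * of_real (r1 b))\<^sup>2
      + (of_real (r0 c) + z * of_real (r1 c))\<^sup>2 + (of_real (r0 d) + z * of_real (r1 d))\<^sup>2 = 0"
    using assms(1) by (simp add: norm_rpoly_def power2_eq_square map_poly_complex_of_real_add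
        map_poly_complex_of_real_mult)
  note rel = isotropic_linear_poly_relations[OF this assms(2), folded x_y_def]
  define al be where "al = Quat (r1 a) (r1 b) (r1 c) (r1 d)" "be = Quat (r0 a) (r0 b) (r0 c) (r0 d)"
  define A where "A = (r1 a)\<^sup>2 + (r1 b)\<^sup>2 + (r1 c)\<^sup>2 + (r1 d)\<^sup>2"
  note rel = rel[folded A_def]
  have "A \<noteq> 0"
  proof
    assume "A = 0"
    then have "r1 p = 0 \<and> r0 p = 0" if "p \<in> {a, b, c, d}" for p
      using that rel(2) by (auto simp: A_def add_nonneg_eq_0_iff)
    then have "p mod ?N = 0" if "p \<in> {a, b, c, d}" for p
      using that by (simp add: rem)
    then show False
      using assms(3) by (auto simp: mod_eq_0_iff_dvd)
  qed
  then have "al \<noteq> 0"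
    by (auto simp: al_be_def A_def quat_ops)
  define h where "h = - (inverse al * be)"
  have alh: "al * h = - be"
    using \<open>al \<noteq> 0\<close> by (simp add: h_def flip: mult.assoc)
  obtain h0 h1 h2 h3 where h: "h = Quat h0 h1 h2 h3"
    by (cases h)
  have be: "- r0 a = r1 a * h0 - r1 b * h1 - r1 c * h2 - r1 d * h3"
    "- r0 b = r1 a * h1 + r1 b * h0 + r1 c * h3 - r1 d * h2"
    "- r0 c = r1 a * h2 - r1 b * h3 + r1 c * h0 + r1 d * h1"
    "- r0 d = r1 a * h3 + r1 b * h2 - r1 c * h1 + r1 d * h0"
    using alh by (simp_all add: al_be_def h quat_ops)
  have "A * h0 = A * x"
    using rel(1) be unfolding A_def by algebra
  then have h0: "h0 = x"
    using \<open>A \<noteq> 0\<close> by simp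
  have "A * (h0\<^sup>2 + h1\<^sup>2 + h2\<^sup>2 + h3\<^sup>2) = A * (x\<^sup>2 + y\<^sup>2)"
    using rel(2) be unfolding A_def by algebra
  then have hn: "h1\<^sup>2 + h2\<^sup>2 + h3\<^sup>2 = y\<^sup>2"
    using \<open>A \<noteq> 0\<close> h0 by simp
  have hN: "(of_real t - qcnj h) * (of_real t - h) = of_real (poly ?N t)" for t
    using hn by (simp add: h h0 qcnj_def of_real_quat quat_ops poly_rquad flip: x_y_def)
      (simp add: power2_eq_square algebra_simps)
  let ?Q = "qpoly (a div ?N) (b div ?N) (c div ?N) (d div ?N)"
  have "qpoly a b c d = (?Q * (ncvar - ncconst (qcnj h)) + ncconst al) * (ncvar - ncconst h)"
  proof (rule quat_ncpoly_eqI)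
    fix t
    have p: "poly p t = poly (p div ?N) t * poly ?N t + (r0 p + r1 p * t)" for p
      using arg_cong[OF div_mult_mod_eq[of p ?N, symmetric], of "\<lambda>f. poly f t"]
      unfolding poly_add poly_mult rem by (simp add: mult.commute)
    have "ev ((?Q * (ncvar - ncconst (qcnj h)) + ncconst al) * (ncvar - ncconst h)) t
        = ev ?Q t * ((of_real t - qcnj h) * (of_real t - h)) + (al * of_real t - al * h)"
      by (simp add: algebra_simps)
    also have "\<dots> = ev ?Q t * of_real (poly ?N t) + (al * of_real t + be)"
      by (simp add: hN alh)
    also have "\<dots> = ev (qpoly a b c d) t"
      using p[of a] p[of b] p[of c] p[of d]
      by (simp add: of_real_quat al_be_def quat_ops)
    finally show "ev (qpoly a b c d) t
        = ev ((?Q * (ncvar - ncconst (qcnj h)) + ncconst al) * (ncvar - ncconst h)) t" ..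
  qed
  then show ?thesis
    by (rule that)
qed

text \<open>
  Induction on the degree. A real zero of \<open>\<nu>(P)\<close> is a zero of \<open>P\<close> and yields a real linear factor. A
  nonreal zero yields either the real quadratic factor itself or a linear right factor.
\<close>

lemma factors_monic_quat_poly:
  assumes "lead_at n P 1"
  shows "factors_up_to_real (dual_poly P 0)"
  using assms
proof (induction n arbitrary: P rule: less_induct)
  case (less n)
  obtain a b c d where P: "P = qpoly a b c d"
    using qpoly_coords by blast
  note deg = lead_at_qpoly[OF less.prems[unfolded P]]
  show ?case
  proof (cases "n = 0")
    case True
    then have "P = of_rpoly 1"
      using less.prems by (intro poly_mapping_eqI) (auto simp: lead_at_def lookup_of_rpoly)
    then show ?thesis
      by (simp add: dual_poly_of_rpoly factors_of_rpoly)
  next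
    case False
    have step: "factors_up_to_real (dual_poly P 0)"
      if "P = R * Y" "lead_at m Y 1" "m > 0" "factors_up_to_real (dual_poly Y 0)" for R Y m
    proof -
      have "m \<le> n" "lead_at (n - m) R 1"
        using lead_at_mult_cancel[of n R Y m] less.prems that by auto
      then have "factors_up_to_real (dual_poly R 0)"
        using that(3) by (intro less.IH[of "n - m"]) auto
      with that show ?thesis
        by (simp add: dual_poly_mult_primal factors_mult)
    qed
    have real_step: "factors_up_to_real (dual_poly P 0)"
      if "E dvd a" "E dvd b" "E dvd c" "E dvd d" "lead_coeff E = 1" "degree E > 0" for E
    proof (rule step[OF _ _ that(6)])
      show "P = qpoly (a div E) (b div E) (c div E) (d div E) * of_rpoly E"
        unfolding P using that by (intro common_dvd_qpoly)
      show "lead_at (degree E) (of_rpoly E) (1 :: quat)"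
        using lead_at_of_rpoly[of E] that by simp
      show "factors_up_to_real (dual_poly (of_rpoly E) 0)"
        using that by (auto simp: dual_poly_of_rpoly intro!: factors_of_rpoly)
    qed
    have "degree (norm_rpoly a b c d) > 0"
      using degree_norm_rpoly deg False by simp
    then show ?thesis
    proof (cases rule: real_poly_cases)
      case (linear r)
      then show ?thesis
        unfolding norm_rpoly_root
        by (intro real_step[of "[:- r, 1:]"]) (auto simp: poly_eq_0_iff_dvd)
    next
      case (quadratic z)
      show ?thesis
      proof (cases "rquad (Re z) (Im z) dvd a \<and> rquad (Re z) (Im z) dvd b
          \<and> rquad (Re z) (Im z) dvd c \<and> rquad (Re z) (Im z) dvd d")
        case True
        then show ?thesis
          by (intro real_step[of "rquad (Re z) (Im z)"]) (auto simp: lead_coeff_rquad[simplified])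
      next
        case False
        then obtain R h where R: "P = R * (ncvar - ncconst h)"
          using linear_right_factor quadratic P by metis
        obtain h0 h1 h2 h3 where h: "h = Quat h0 h1 h2 h3"
          by (cases h)
        have "factors_up_to_real (dual_poly (ncvar - ncconst h) 0)"
          by (rule factors_linearI[of _ h0 "- h1" "- h2" "- h3" 0 0 0])
            (simp_all add: h of_real_quat quat_ops)
        then show ?thesis
          by (intro step[OF R lead_at_linear]) simp_all
      qed
    qed
  qed
qed

section \<open>The maximal real polynomial factor\<close>

lemma real_factor_qpoly:
  "real_factor M (qpoly a b c d) \<longleftrightarrow> M dvd a \<and> M dvd b \<and> M dvd c \<and> M dvd d"
proof
  assume "real_factor M (qpoly a b c d)"
  then obtain R where R: "qpoly a b c d = of_rpoly M * R"
    by (auto simp: real_factor_def)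
  obtain a' b' c' d' where R': "R = qpoly a' b' c' d'"
    using qpoly_coords by blast
  have "qpoly a b c d = qpoly (M * a') (M * b') (M * c') (M * d')"
    unfolding R R' by (rule quat_ncpoly_eqI) (simp add: of_real_quat quat_ops)
  then show "M dvd a \<and> M dvd b \<and> M dvd c \<and> M dvd d"
    by (auto simp: qpoly_inject)
next
  assume "M dvd a \<and> M dvd b \<and> M dvd c \<and> M dvd d"
  then have "qpoly a b c d = qpoly (a div M) (b div M) (c div M) (d div M) * of_rpoly M"
    by (intro common_dvd_qpoly) auto
  also have "\<dots> = of_rpoly M * qpoly (a div M) (b div M) (c div M) (d div M)"
    by (rule quat_ncpoly_eqI) (simp add: of_real_quat quat_ops mult.commute)
  finally show "real_factor M (qpoly a b c d)"
    by (auto simp: real_factor_def)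
qed

text \<open>
  Real factors of \<open>P\<close> are the common divisors of its four coordinates. Hence the monic greatest
  common divisor of the coordinates is the unique monic real factor of maximal degree, which
  justifies the definite description in the definition of \<^const>\<open>mrpf\<close>.
\<close>

lemma mrpf_maximal:
  assumes "P \<noteq> 0"
  shows "lead_coeff (mrpf P) = 1" "real_factor (mrpf P) P"
    "lead_coeff N = 1 \<Longrightarrow> real_factor N P \<Longrightarrow> degree N \<le> degree (mrpf P)"
proof -
  obtain a b c d where P: "P = qpoly a b c d"
    using qpoly_coords by blast
  let ?max = "\<lambda>M. lead_coeff M = 1 \<and> real_factor M P \<and>
     (\<forall>N. lead_coeff N = 1 \<and> real_factor N P \<longrightarrow> degree N \<le> degree M)"
  define g where "g = gcd a (gcd b (gcd c d))"
  have "g \<noteq> 0"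
  proof
    assume "g = 0"
    then have "P = qpoly 0 0 0 0"
      by (simp add: g_def P)
    also have "\<dots> = 0"
      by (rule quat_ncpoly_eqI) (simp add: zero_quat_def)
    finally show False
      using assms by contradiction
  qed
  define G where "G = smult (inverse (lead_coeff g)) g"
  have G: "lead_coeff G = 1" "G \<noteq> 0"
    using \<open>g \<noteq> 0\<close> by (simp_all add: G_def)
  have iff: "real_factor N P \<longleftrightarrow> N dvd G" for N
    using \<open>g \<noteq> 0\<close> by (simp add: P real_factor_qpoly G_def g_def dvd_smult_iff)
  have "?max G"
    using G by (auto simp: iff dvd_imp_degree_le)
  moreover have "M = G" if "?max M" for M
  proof -
    have "M dvd G"
      using that iff by blast
    then obtain K where K: "G = M * K"
      by (elim dvdE)
    have "real_factor G P"
      by (simp add: iff)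
    with that G(1) have "degree G \<le> degree M"
      by simp
    then have "degree K = 0"
      using K G(2) by (auto simp: degree_mult_eq)
    then obtain k where k: "K = [:k:]"
      using degree_0_id by metis
    have "lead_coeff G = lead_coeff M * lead_coeff K"
      unfolding K by (rule lead_coeff_mult)
    moreover have "lead_coeff M = 1"
      using that by blast
    ultimately have "k = 1"
      unfolding G(1) k by simp
    then show ?thesis
      unfolding K k by simp
  qed
  ultimately have "\<exists>!M. ?max M"
    by (rule ex1I[of _ G])
  from theI'[OF this] have "?max (mrpf P)"
    unfolding mrpf_def .
  then show "lead_coeff (mrpf P) = 1" "real_factor (mrpf P) P"
    "lead_coeff N = 1 \<Longrightarrow> real_factor N P \<Longrightarrow> degree N \<le> degree (mrpf P)"
    by blast+
qed

section \<open>Reduction to translations\<close>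

lemma degree_mult_less_double:
  assumes "degree p < n \<or> p = 0" "degree q \<le> n" "n > 0"
  shows "degree (p * q :: real poly) < 2 * n"
  using assms degree_mult_le[of p q] by auto

text \<open>For \<open>C = P + \<epsilon> Q\<close> the dual part of \<open>\<nu>(C)\<close> is \<open>P Q\<^sup>* + Q P\<^sup>*\<close>, which is twice the left-hand side.\<close>

lemma motion_poly_study:
  assumes "motion_poly (dual_poly (qpoly a b c d) (qpoly p q r s))"
  shows "a * p + b * q + c * r + d * s = 0"
proof (rule poly_ext)
  fix x
  obtain E where "norm_poly (dual_poly (qpoly a b c d) (qpoly p q r s)) = of_rpoly E"
    using assms by (auto simp: motion_poly_def)
  then have "ev (norm_poly (dual_poly (qpoly a b c d) (qpoly p q r s))) x = ev (of_rpoly E) x"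
    by simp
  then show "poly (a * p + b * q + c * r + d * s) x = poly 0 x"
    by (simp add: norm_poly_def dqcnj_def qcnj_def of_real_dual of_real_quat dual_ops quat_ops
        algebra_simps)
qed

lemma lead_at_prod_list: "lead_at (length hs) (prod_list (map (\<lambda>h. ncvar - ncconst h) hs)) 1"
  for hs :: "'a :: ring_1 list"
proof (induction hs)
  case Nil
  show ?case
    by (simp add: lead_at_def lookup_one)
next
  case (Cons h hs)
  then show ?case
    using lead_at_mult[OF lead_at_linear[of h] Cons.IH] by simp
qed

text \<open>
  Let \<open>G = mrpf P\<close> and \<open>P = G P'\<close>. The translation with vector \<open>Q P\<^sup>* / \<nu>(P) = Q P'\<^sup>* / (G \<nu>(P'))\<close> has
  only simple real poles and is a proper fraction because \<open>deg Q < deg P\<close>; multiplying it by \<open>P\<close>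
  gives a real multiple of \<open>P + \<epsilon> Q\<close>.
\<close>

lemma factors_motion_poly:
  fixes P Q :: "quat ncpoly"
  assumes lead: "lead_at n P 1" "\<And>k. k \<ge> n \<Longrightarrow> Poly_Mapping.lookup Q k = 0"
    and motion: "motion_poly (dual_poly P Q)"
    and simple: "\<And>r. poly (mrpf P) r = 0 \<Longrightarrow> order r (mrpf P) = 1"
  shows "factors_up_to_real (dual_poly P Q)"
proof (cases "n = 0")
  case True
  then have "dual_poly P Q = of_rpoly 1"
    using lead by (intro poly_mapping_eqI)
      (auto simp: lookup_dual_poly lead_at_def lookup_of_rpoly dual_ops)
  then show ?thesis
    by (simp add: factors_of_rpoly)
next
  case False
  obtain a b c d where P: "P = qpoly a b c d"
    using qpoly_coords by blast
  obtain p q r s where Q: "Q = qpoly p q r s"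
    using qpoly_coords by blast
  note degP = lead_at_qpoly[OF lead(1)[unfolded P]]
  have degQ: "degree p < n" "degree q < n" "degree r < n" "degree s < n"
    using lead(2) False unfolding Q lookup_qpoly zero_quat_def
    by (auto intro!: degree_lessI)
  have study: "a * p + b * q + c * r + d * s = 0"
    using motion unfolding P Q by (rule motion_poly_study)
  have "P \<noteq> 0"
    using lead(1) by (auto simp: lead_at_def)
  define G where "G = mrpf P"
  note max = mrpf_maximal[OF \<open>P \<noteq> 0\<close>, folded G_def]
  have "G \<noteq> 0"
    using max(1) by auto
  obtain a' b' c' d' where fac: "a = G * a'" "b = G * b'" "c = G * c'" "d = G * d'"
    using max(2) unfolding P real_factor_qpoly by (auto elim!: dvdE)
  \<comment> \<open>The vector parts of \<open>Q P\<^sup>*\<close> and of \<open>Q P'\<^sup>*\<close>; the real parts vanish by the Study condition.\<close>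
  define v1 v2 v3 where "v1 = - p * b + q * a - r * d + s * c"
    "v2 = - p * c + q * d + r * a - s * b" "v3 = - p * d - q * c + r * b + s * a"
  define w1 w2 w3 where "w1 = - p * b' + q * a' - r * d' + s * c'"
    "w2 = - p * c' + q * d' + r * a' - s * b'" "w3 = - p * d' - q * c' + r * b' + s * a'"
  have v: "v1 = G * w1" "v2 = G * w2" "v3 = G * w3"
    by (simp_all add: v1_v2_v3_def w1_w2_w3_def fac algebra_simps)
  let ?W = "norm_rpoly a b c d" and ?W' = "G * norm_rpoly a' b' c' d'"
  have W: "?W = G * ?W'"
    by (simp add: norm_rpoly_def fac power2_eq_square algebra_simps)
  have degW: "degree ?W = 2 * n"
    using degree_norm_rpoly degP False by simp
  then have nz: "?W \<noteq> 0" "?W' \<noteq> 0" "norm_rpoly a' b' c' d' \<noteq> 0"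
    using W False by auto
  have degW': "degree ?W = degree G + degree ?W'"
    unfolding W using \<open>G \<noteq> 0\<close> nz(2) by (rule degree_mult_eq)
  \<comment> \<open>A real zero of \<open>\<nu>(P')\<close> gives a real linear factor of \<open>P'\<close>, against the maximality of \<open>G\<close>.\<close>
  have no_root: "poly (norm_rpoly a' b' c' d') t \<noteq> 0" for t
  proof
    assume "poly (norm_rpoly a' b' c' d') t = 0"
    then have "[:- t, 1:] dvd a'" "[:- t, 1:] dvd b'" "[:- t, 1:] dvd c'" "[:- t, 1:] dvd d'"
      unfolding norm_rpoly_root by (simp_all add: poly_eq_0_iff_dvd)
    then have "real_factor (G * [:- t, 1:]) P"
      unfolding P real_factor_qpoly fac by (intro conjI mult_dvd_mono dvd_refl)
    moreover have "lead_coeff (G * [:- t, 1:]) = 1"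
      using max(1) unfolding lead_coeff_mult by simp
    ultimately have "degree (G * [:- t, 1:]) \<le> degree G"
      by (rule max(3)[rotated])
    moreover have "degree (G * [:- t, 1:]) = degree G + 1"
      using \<open>G \<noteq> 0\<close> by (subst degree_mult_eq) auto
    ultimately show False
      by simp
  qed
  have poles: "\<not> [:- t, 1:]\<^sup>2 dvd ?W'" for t
  proof
    assume "[:- t, 1:]\<^sup>2 dvd ?W'"
    then have "2 \<le> order t ?W'"
      using nz(2) by (simp add: order_divides)
    moreover have "order t ?W' = order t G + order t (norm_rpoly a' b' c' d')"
      using nz(2) by (rule order_mult)
    moreover have "order t (norm_rpoly a' b' c' d') = 0"
      using no_root by (simp add: order_0I)
    moreover have "order t G \<le> 1"
      using simple[of t] order_0I[of G t] unfolding G_def by (cases "poly (mrpf P) t = 0") auto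
    ultimately show False
      by simp
  qed
  have le: "degree a \<le> n" "degree b \<le> n" "degree c \<le> n" "degree d \<le> n"
    using degP by auto
  have "degree v1 < 2 * n" "degree v2 < 2 * n" "degree v3 < 2 * n"
    unfolding v1_v2_v3_def using degQ le False
    by (auto intro!: degree_add_less degree_diff_less degree_mult_less_double)
  moreover have "w = 0 \<or> degree w < degree ?W'" if "degree (G * w) < 2 * n" for w
    using that degW degW' \<open>G \<noteq> 0\<close> by (cases "w = 0") (auto simp: degree_mult_eq)
  ultimately have "factors_up_to_real (translation ?W' w1 w2 w3)"
    unfolding v using nz(2) poles by (intro factors_translation_simple_real_poles) blast+
  then have "factors_up_to_real (translation ?W v1 v2 v3)"
    using nz(2,1) by (rule factors_translation_cong) (simp_all only: W v mult_ac)
  moreover have "factors_up_to_real (dual_poly P 0)"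
    using lead(1) by (rule factors_monic_quat_poly)
  ultimately have "factors_up_to_real (translation ?W v1 v2 v3 * dual_poly P 0)"
    by (rule factors_mult)
  \<comment> \<open>The identity \<open>(\<nu>(P) + \<epsilon> Q P\<^sup>*) P = (P + \<epsilon> Q) \<nu>(P)\<close>.\<close>
  also have "translation ?W v1 v2 v3 * dual_poly P 0 = dual_poly P Q * of_rpoly ?W"
  proof (rule dquat_ncpoly_eqI)
    fix x
    define A B C D where "A = poly a x" "B = poly b x" "C = poly c x" "D = poly d x"
    define X Y Z U where "X = poly p x" "Y = poly q x" "Z = poly r x" "U = poly s x"
    have st: "A * X + B * Y + C * Z + D * U = 0"
      using arg_cong[OF study, of "\<lambda>f. poly f x"] by (simp add: A_B_C_D_def X_Y_Z_U_def)
    define N where "N = A\<^sup>2 + B\<^sup>2 + C\<^sup>2 + D\<^sup>2"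
    define V1 V2 V3 where "V1 = - X * B + Y * A - Z * D + U * C"
      "V2 = - X * C + Y * D + Z * A - U * B" "V3 = - X * D - Y * C + Z * B + U * A"
    have L: "ev (translation ?W v1 v2 v3 * dual_poly P 0) x
      = Dual (Quat N 0 0 0) (Quat 0 V1 V2 V3) * Dual (Quat A B C D) 0"
      by (simp add: P norm_rpoly_def v1_v2_v3_def A_B_C_D_def X_Y_Z_U_def N_def V1_V2_V3_def)
    have R: "ev (dual_poly P Q * of_rpoly ?W) x
      = Dual (Quat A B C D) (Quat X Y Z U) * Dual (Quat N 0 0 0) 0"
      by (simp add: P Q norm_rpoly_def of_real_dual of_real_quat A_B_C_D_def X_Y_Z_U_def N_def)
    have "X * N = - (V1 * B) - V2 * C - V3 * D" "Y * N = V1 * A + V2 * D - V3 * C"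
      "Z * N = V2 * A - V1 * D + V3 * B" "U * N = V1 * C - V2 * B + V3 * A"
      using st unfolding N_def V1_V2_V3_def by algebra+
    then show "ev (translation ?W v1 v2 v3 * dual_poly P 0) x = ev (dual_poly P Q * of_rpoly ?W) x"
      unfolding L R by (simp add: dual_ops quat_ops mult.commute)
  qed
  finally show ?thesis
    using nz(1) by (rule factors_real_multD)
qed

theorem theorem7:
  fixes C :: "dquat ncpoly" and P Q :: "quat ncpoly"
  assumes "C = dual_poly P Q"
    and "ncmonic C"
    and "unbounded_motion_poly C"
    and "\<And>r :: real. poly (mrpf P) r = 0 \<Longrightarrow> order r (mrpf P) = 1"
  shows "\<exists>D :: real poly. D \<noteq> 0 \<and>
    (\<exists>hs :: dquat list.
       length hs = ncdegree (C * of_rpoly D) \<and>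
       C * of_rpoly D =
         ncconst (nclead (C * of_rpoly D)) * prod_list (map (\<lambda>h. ncvar - ncconst h) hs) \<and>
       (\<forall>h \<in> set hs. motion_poly (ncvar - ncconst h)))"
proof -
  have "lead_at (ncdegree C) C 1"
    using lead_at_ncdegree[of C] assms(2) by (simp add: ncmonic_def)
  then have "lead_at (ncdegree C) P 1" "\<And>k. k \<ge> ncdegree C \<Longrightarrow> Poly_Mapping.lookup Q k = 0"
    unfolding assms(1) by (auto simp: lead_at_def lookup_dual_poly dual_ops le_less)
  moreover have "motion_poly (dual_poly P Q)"
    using assms(1,3) by (simp add: unbounded_motion_poly_def)
  ultimately have "factors_up_to_real C"
    unfolding assms(1) using assms(4) by (rule factors_motion_poly)
  then obtain D hs where D: "D \<noteq> 0"
    "C * of_rpoly D = prod_list (map (\<lambda>h. ncvar - ncconst h) hs)"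
    "\<forall>h\<in>set hs. motion_poly (ncvar - ncconst h)"
    by (auto simp: factors_up_to_real_def)
  have lead: "lead_at (length hs) (C * of_rpoly D) 1"
    unfolding D(2) by (rule lead_at_prod_list)
  then have "C * of_rpoly D \<noteq> 0"
    by (auto simp: lead_at_def)
  then have "length hs = ncdegree (C * of_rpoly D)" "nclead (C * of_rpoly D) = 1"
    using lead_at_unique[OF lead lead_at_ncdegree] nclead_nonzero by auto
  moreover have "ncconst 1 = (1 :: dquat ncpoly)"
    by (simp add: ncconst_def)
  ultimately show ?thesis
    using D by (intro exI[of _ D] conjI exI[of _ hs]) simp_all
qed

end
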